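(* For any monotone tree poset $T$ and $\varepsilon>0$, there exist $\delta>0$ and $n_0$ such that for any $n\ge n_0$, any family $\mathcal F\subseteq 2^{[n]}$ of size $|\mathcal F|\ge (h(T)-1+\varepsilon)\binom{n}{\lfloor n/2\rfloor}$ contains at least $\delta n^{x(T)}\binom{n}{\lfloor n/2\rfloor}$ copies of $T$.
   Context: For a finite poset $(P,\le)$ and $\mathcal F\subseteq 2^{[n]}$, a (non-induced) copy of $P$ in $\mathcal F$ is a subfamily $\mathcal G\subseteq \mathcal F$ with a bijection $i:P\to\mathcal G$ such that $p\le q$ implies $i(p)\subseteq i(q)$; $\mathcal F$ is $P$-free if it contains no copy of $P$. The Hasse diagram of $P$ has an arc $pq$ whenever $p<q$ and no $z$ satisfies $p<z<q$ (write $p\prec q$). $P$ is a tree poset if its undirected Hasse diagram is a tree. A tree poset $T$ is upward (downward) monotone if every $x\in T$ has at most one $y\in T$ with $y\prec x$ (with $x\prec y$); $T$ is monotone if it is upward or downward monotone. $h(T)$ is the height of $T$, the maximum number of elements of a chain in $T$. $e(P)$ is the largest integer $m$ such that for every $n$ and every $i$, the family $\binom{[n]}{i+1}\cup\dots\cup\binom{[n]}{i+m}$ is $P$-free. The $k$ middle levels of $2^{[n]}$ are the levels $\binom{[n]}{j}$ with $\lfloor (n-k)/2\rfloor+1\le j\le \lfloor (n-k)/2\rfloor+k$. $x(P)$ is the maximum, over all copies $\mathcal G$ of $P$ all of whose sets lie in the $e(P)+1$ middle levels of $2^{[n]}$, of $|\bigcup_{G\in\mathcal G}G|-|\bigcap_{G\in\mathcal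 G}G|$ (for $n$ sufficiently large; this value does not depend on $n$). *)

theory Defs
  imports Complex_Main
begin

text \<open>
  A finite poset is a carrier \<open>P\<close> with a reflexive order relation \<open>r\<close>, where
  \<^const>\<open>partial_order_on\<close> also ensures \<open>r \<subseteq> P \<times> P\<close>.  The ground set
  \<open>[n]\<close> is \<open>{1..n}\<close>.
\<close>

definition finite_poset :: "'a set \<Rightarrow> 'a rel \<Rightarrow> bool" where
  "finite_poset P r \<longleftrightarrow> finite P \<and> partial_order_on P r"

text \<open>
  Copies are counted as subfamilies, so different bijections onto the same
  subfamily give one copy.
\<close>

definition copies :: "'a set \<Rightarrow> 'a rel \<Rightarrow> nat set set \<Rightarrow> nat set set set" where
  "copies P r F =
     {G. G \<subseteq> F \<and> (\<exists>i. bij_betw i P G \<and> monotone_on P (\<lambda>p q. (p, q) \<in> r) (\<subseteq>) i)}"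

definition poset_free :: "'a set \<Rightarrow> 'a rel \<Rightarrow> nat set set \<Rightarrow> bool" where
  "poset_free P r F \<longleftrightarrow> copies P r F = {}"

definition hasse_arc :: "'a rel \<Rightarrow> 'a \<Rightarrow> 'a \<Rightarrow> bool" where
  "hasse_arc r p q \<longleftrightarrow>
     (p, q) \<in> r \<and> p \<noteq> q \<and>
     \<not> (\<exists>z. (p, z) \<in> r \<and> p \<noteq> z \<and> (z, q) \<in> r \<and> z \<noteq> q)"

definition hasse_edge :: "'a rel \<Rightarrow> 'a \<Rightarrow> 'a \<Rightarrow> bool" where
  "hasse_edge r p q \<longleftrightarrow> hasse_arc r p q \<or> hasse_arc r q p"

text \<open>
  A tree is a nonempty connected graph without cycles.  The cycle \<open>x\<^sub>1, \<dots>, x\<^sub>k, x\<^sub>1\<close>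
  is given by the list of its \<open>k \<ge> 3\<close> distinct vertices.  (The predicate \<open>tree\<close> of the
  entry \<open>Graph_Theory\<close> refers to directed cycles and is not the notion needed here.)
\<close>

definition undirected_cycle :: "('a \<Rightarrow> 'a \<Rightarrow> bool) \<Rightarrow> 'a list \<Rightarrow> bool" where
  "undirected_cycle E xs \<longleftrightarrow>
     3 \<le> length xs \<and> distinct xs \<and> successively E xs \<and> E (last xs) (hd xs)"

definition undirected_tree :: "'a set \<Rightarrow> ('a \<Rightarrow> 'a \<Rightarrow> bool) \<Rightarrow> bool" where
  "undirected_tree V E \<longleftrightarrow>
     V \<noteq> {} \<and> (\<forall>u\<in>V. \<forall>v\<in>V. E\<^sup>*\<^sup>* u v) \<and>
     \<not> (\<exists>xs. set xs \<subseteq> V \<and> undirected_cycle E xs)"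

definition tree_poset :: "'a set \<Rightarrow> 'a rel \<Rightarrow> bool" where
  "tree_poset T r \<longleftrightarrow> finite_poset T r \<and> undirected_tree T (hasse_edge r)"

definition upward_monotone :: "'a set \<Rightarrow> 'a rel \<Rightarrow> bool" where
  "upward_monotone T r \<longleftrightarrow> (\<forall>x\<in>T. \<exists>\<^sub>\<le>\<^sub>1 y. y \<in> T \<and> hasse_arc r y x)"

definition downward_monotone :: "'a set \<Rightarrow> 'a rel \<Rightarrow> bool" where
  "downward_monotone T r \<longleftrightarrow> (\<forall>x\<in>T. \<exists>\<^sub>\<le>\<^sub>1 y. y \<in> T \<and> hasse_arc r x y)"

definition monotone_tree_poset :: "'a set \<Rightarrow> 'a rel \<Rightarrow> bool" where
  "monotone_tree_poset T r \<longleftrightarrow>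
     tree_poset T r \<and> (upward_monotone T r \<or> downward_monotone T r)"

definition poset_height :: "'a set \<Rightarrow> 'a rel \<Rightarrow> nat" where
  "poset_height P r = Max {card C |C. C \<subseteq> P \<and> C \<in> Chains r}"

text \<open>
  The levels \<open>i + 1, \<dots>, i + m\<close>.  The offset \<open>i\<close> is an integer, so that level \<open>0\<close> may
  occur; levels outside \<open>0, \<dots>, n\<close> are empty.
\<close>

definition consecutive_levels :: "nat \<Rightarrow> int \<Rightarrow> nat \<Rightarrow> nat set set" where
  "consecutive_levels n i m =
     {A. A \<subseteq> {1..n} \<and> i + 1 \<le> int (card A) \<and> int (card A) \<le> i + int m}"

definition middle_levels :: "nat \<Rightarrow> nat \<Rightarrow> nat set set" where
  "middle_levels n k = consecutive_levels n \<lfloor>(real n - real k) / 2\<rfloor> k"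

text \<open>
  The maximum exists for nonempty \<open>P\<close>: \<open>m = 0\<close> qualifies, and \<open>card P\<close> consecutive
  levels can contain a chain of \<open>card P\<close> sets, which is a copy of \<open>P\<close>.
\<close>

definition e_number :: "'a set \<Rightarrow> 'a rel \<Rightarrow> nat" where
  "e_number P r =
     (GREATEST m. \<forall>n i. poset_free P r (consecutive_levels n i m))"

definition x_number_at :: "'a set \<Rightarrow> 'a rel \<Rightarrow> nat \<Rightarrow> nat" where
  "x_number_at P r n =
     Max {card (\<Union>G) - card (\<Inter>G) |G. G \<in> copies P r (middle_levels n (e_number P r + 1))}"

text \<open>
  The value for all sufficiently large \<open>n\<close>.  It is independent of \<open>n\<close> when the Hasse
  diagram of \<open>P\<close> is connected, but not for arbitrary \<open>P\<close> (e.g. antichains).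
\<close>

definition x_number :: "'a set \<Rightarrow> 'a rel \<Rightarrow> nat" where
  "x_number P r = (THE x. \<forall>\<^sub>F n in sequentially. x_number_at P r n = x)"

end

theory Submission
  imports Defs "HOL-Real_Asymp.Real_Asymp" "HOL-Library.FuncSet"
begin

text \<open>
  Let \<open>T\<close> be upward monotone with root at the bottom (the other case follows by taking
  complements) and let \<open>h\<close> be its height. Call a set of \<open>F\<close> \<open>1\<close>-rich if a random maximal
  chain above it meets \<open>F\<close> again with probability at least \<open>\<eta>\<close>, and iterate. The sets lost in
  one step are almost only the last members of \<open>F\<close> on random chains, so at most
  \<open>1 / (1 - \<eta>)\<close> times the middle binomial coefficient are lost, and after \<open>h - 1\<close> steps
  a positive proportion of the middle binomial coefficient remains. By the strong Markov
  property, a random chain above a \<open>(b + j)\<close>-rich set meets a \<open>b\<close>-rich set at distance at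
  least \<open>j\<close> with probability at least \<open>\<eta> ^ j\<close>, so at least \<open>c * n ^ j\<close> such sets lie above
  it. Embedding \<open>T\<close> vertex by vertex, with inner vertices as low and leaves as high as
  possible in terms of richness, gives the exponent \<open>x(T)\<close>, since the same choice of
  levels realises \<open>x(T)\<close> in \<open>h = e(T) + 1\<close> consecutive levels.
\<close>

section \<open>Random maximal chains\<close>

text \<open>The probability that a random maximal chain from \<open>A\<close> up to
  \<open>U\<close>, which adds one uniformly chosen new point at a time, meets \<open>G\<close>;
  \<open>A\<close> itself counts. At \<open>A = U\<close> outside \<open>G\<close> the sum is empty
  and the value is 0. The test \<open>finite U\<close> makes the recursion terminate.\<close>

function hit :: "'b set \<Rightarrow> 'b set set \<Rightarrow> 'b set \<Rightarrow> real" where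
  "hit U G A = (if A \<in> G then 1
     else if finite U then (\<Sum>x\<in>U - A. hit U G (insert x A)) / real (card (U - A)) else 0)"
  by auto
termination
proof (relation "measure (\<lambda>(U, G, A). card (U - A))", goal_cases)
  case (2 U G A x)
  then have "card (U - insert x A) < card (U - A)"
    by (intro psubset_card_mono) auto
  then show ?case by simp
qed simp

declare hit.simps [simp del]

text \<open>The same probability with the starting set \<open>A\<close> itself left out.\<close>

definition hit_above :: "'b set \<Rightarrow> 'b set set \<Rightarrow> 'b set \<Rightarrow> real" where
  "hit_above U G A = (\<Sum>x\<in>U - A. hit U G (insert x A)) / real (card (U - A))"

text \<open>The expected number of members of \<open>S\<close> on the random chain from
  \<open>A\<close> to \<open>U\<close>: the set of a given size on the chain is uniform among the
  supersets of \<open>A\<close> of that size, so each \<open>B\<close> is passed with the reciprocal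
  of a binomial coefficient as probability.\<close>

definition chain_weight :: "'b set \<Rightarrow> 'b set set \<Rightarrow> 'b set \<Rightarrow> real" where
  "chain_weight U S A = (\<Sum>B | B \<in> S \<and> A \<subseteq> B. 1 / real (card (U - A) choose card (B - A)))"

lemma hit_eq: "finite U \<Longrightarrow> hit U G A = (if A \<in> G then 1 else hit_above U G A)"
  by (subst hit.simps) (simp add: hit_above_def)

text \<open>Induction descending from \<open>U\<close>; it follows the recursion of
  \<open>hit\<close>, which passes to sets with one more point.\<close>

lemma superset_induct [consumes 2, case_names step]:
  assumes "finite U" "A \<subseteq> U"
    and "\<And>A. A \<subseteq> U \<Longrightarrow> (\<And>x. x \<in> U - A \<Longrightarrow> P (insert x A)) \<Longrightarrow> P A"
  shows "P A"
  using assms(2)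
proof (induction "card (U - A)" arbitrary: A rule: less_induct)
  case less
  show ?case
  proof (rule assms(3)[OF less.prems])
    fix x assume "x \<in> U - A"
    then show "P (insert x A)"
      using less.prems \<open>finite U\<close> by (intro less.hyps psubset_card_mono) auto
  qed
qed

lemma average_mono:
  fixes f g :: "'b \<Rightarrow> real"
  assumes "\<And>x. x \<in> X \<Longrightarrow> f x \<le> g x"
  shows "(\<Sum>x\<in>X. f x) / real (card X) \<le> (\<Sum>x\<in>X. g x) / real (card X)"
  using assms by (intro divide_right_mono sum_mono) auto

lemma hit_bounds:
  assumes "finite U" "A \<subseteq> U"
  shows "0 \<le> hit U G A \<and> hit U G A \<le> 1"
  using assms
proof (induction A rule: superset_induct)
  case (step A)
  have "hit_above U G A \<le> (\<Sum>x\<in>U - A. 1) / real (card (U - A))"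
    unfolding hit_above_def using step by (intro average_mono) auto
  also have "\<dots> \<le> 1"
    by simp
  finally have "hit_above U G A \<le> 1" .
  moreover have "0 \<le> hit_above U G A"
    unfolding hit_above_def using step by (intro divide_nonneg_nonneg sum_nonneg) auto
  ultimately show ?case
    using assms(1) by (simp add: hit_eq)
qed

lemma hit_above_bounds:
  assumes "finite U" "A \<subseteq> U"
  shows "0 \<le> hit_above U G A" "hit_above U G A \<le> 1"
proof -
  show "0 \<le> hit_above U G A"
    unfolding hit_above_def using assms
    by (intro divide_nonneg_nonneg sum_nonneg) (auto simp: hit_bounds)
  have "hit_above U G A \<le> (\<Sum>x\<in>U - A. 1) / real (card (U - A))"
    unfolding hit_above_def using assms by (intro average_mono) (simp add: hit_bounds)
  also have "\<dots> \<le> 1"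
    by simp
  finally show "hit_above U G A \<le> 1" .
qed

lemma chain_weight_nonneg: "0 \<le> chain_weight U S A"
  unfolding chain_weight_def by (intro sum_nonneg) auto

lemma chain_weight_mono:
  assumes "S \<subseteq> S'" "finite S'"
  shows "chain_weight U S A \<le> chain_weight U S' A"
  unfolding chain_weight_def using assms by (intro sum_mono2) auto

text \<open>Linearity of expectation after conditioning on the first point that the chain
  adds.\<close>

lemma chain_weight_rec:
  assumes U: "finite U" "A \<subseteq> U" and S: "S \<subseteq> Pow U"
  shows "chain_weight U S A =
    of_bool (A \<in> S) + (\<Sum>x\<in>U - A. chain_weight U S (insert x A)) / real (card (U - A))"
proof -
  let ?N = "card (U - A)"
  have finS: "finite S"
    using S U(1) finite_subset by (metis finite_Pow_iff)
  define S' where "S' = {B \<in> S. A \<subset> B}"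
  have finS': "finite S'"
    using finS by (simp add: S'_def)
  \<comment> \<open>For a fixed \<open>B\<close> only the first points in \<open>B - A\<close> can
    still lead to \<open>B\<close>; the absorption identity for binomial coefficients then evaluates
    the sum.\<close>
  have inner_sum: "(\<Sum>x | x \<in> U - A \<and> x \<in> B. 1 / real (card (U - insert x A) choose card (B - insert x A)))
      = real ?N * (1 / real (?N choose card (B - A)))" if "B \<in> S'" for B
  proof -
    have B: "A \<subset> B" "B \<subseteq> U"
      using that S by (auto simp: S'_def)
    have fB: "finite (B - A)"
      using B U(1) by (meson finite_Diff finite_subset)
    obtain s where s: "card (B - A) = Suc s"
      using B fB by (cases "card (B - A)") auto
    have le: "card (B - A) \<le> ?N"
      using B U by (intro card_mono) auto
    then obtain m where m: "?N = Suc m" "s \<le> m"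
      using s by (cases ?N) auto
    have "(\<Sum>x | x \<in> U - A \<and> x \<in> B. 1 / real (card (U - insert x A) choose card (B - insert x A)))
      = (\<Sum>x\<in>B - A. 1 / real (m choose s))"
    proof (rule sum.cong)
      fix x assume x: "x \<in> B - A"
      have "U - insert x A = U - A - {x}" "B - insert x A = B - A - {x}"
        by auto
      then have "card (U - insert x A) = m" "card (B - insert x A) = s"
        using x B U m s fB by auto
      then show "1 / real (card (U - insert x A) choose card (B - insert x A)) = 1 / real (m choose s)"
        by simp
    qed (use B in auto)
    also have "\<dots> = real (Suc s) / real (m choose s)"
      by (simp add: s)
    also have "\<dots> = real ?N * (1 / real (?N choose card (B - A)))"
    proof -
      have "real (Suc s) * real (Suc m choose Suc s) = real (Suc m) * real (m choose s)"
        using Suc_times_binomial_eq[of m s] by (metis mult.commute of_nat_mult)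
      moreover have "real (m choose s) > 0" "real (Suc m choose Suc s) > 0"
        using m(2) by (simp_all del: binomial_Suc_Suc)
      ultimately show ?thesis
        unfolding m(1) s by (simp add: field_simps del: binomial_Suc_Suc)
    qed
    finally show ?thesis .
  qed
  have "(\<Sum>x\<in>U - A. chain_weight U S (insert x A)) =
      (\<Sum>x\<in>U - A. \<Sum>B | B \<in> S' \<and> x \<in> B.
         1 / real (card (U - insert x A) choose card (B - insert x A)))"
    unfolding chain_weight_def S'_def by (intro sum.cong) auto
  also have "\<dots> = (\<Sum>B\<in>S'. \<Sum>x | x \<in> U - A \<and> x \<in> B.
         1 / real (card (U - insert x A) choose card (B - insert x A)))"
    using U(1) finS' by (intro sum.swap_restrict) auto
  also have "\<dots> = real ?N * (\<Sum>B\<in>S'. 1 / real (?N choose card (B - A)))"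
    by (simp only: inner_sum sum_distrib_left cong: sum.cong)
  finally have 1: "(\<Sum>x\<in>U - A. chain_weight U S (insert x A)) =
      real ?N * (\<Sum>B\<in>S'. 1 / real (?N choose card (B - A)))" .
  have 2: "(\<Sum>x\<in>U - A. chain_weight U S (insert x A)) / real ?N =
      (\<Sum>B\<in>S'. 1 / real (?N choose card (B - A)))"
  proof (cases "?N = 0")
    case True
    then have "U = A"
      using U by auto
    then have "S' = {}"
      using S by (auto simp: S'_def)
    then show ?thesis
      using True by simp
  qed (simp add: 1)
  have "{B. B \<in> S \<and> A \<subseteq> B} = (if A \<in> S then insert A S' else S')" "A \<notin> S'"
    by (auto simp: S'_def)
  then show ?thesis
    unfolding 2 by (simp add: chain_weight_def finS')
qed

text \<open>The strong Markov property: stop the chain at its first member \<open>C\<close> of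
  \<open>G\<close>; from there it is expected to pass at least \<open>c\<close> members of
  \<open>S\<close>. The bound \<open>m\<close> restricts the hypothesis to sets that are at least as
  large as a chosen size, since the chain only grows.\<close>

lemma hit_le_chain_weight:
  assumes "finite U" "A \<subseteq> U" "S \<subseteq> Pow U" "c \<ge> 0"
    and "\<And>C. C \<in> G \<Longrightarrow> C \<subseteq> U \<Longrightarrow> m \<le> card C \<Longrightarrow> c \<le> chain_weight U S C"
    and "m \<le> card A"
  shows "c * hit U G A \<le> chain_weight U S A"
  using assms(1,2,6)
proof (induction A rule: superset_induct)
  case (step A)
  show ?case
  proof (cases "A \<in> G")
    case True
    then show ?thesis
      using assms(1,5) step by (simp add: hit_eq)
  next
    case False
    have "c * hit U G A = (\<Sum>x\<in>U - A. c * hit U G (insert x A)) / real (card (U - A))"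
      using False assms(1) by (simp add: hit_eq hit_above_def sum_distrib_left)
    also have "\<dots> \<le> (\<Sum>x\<in>U - A. chain_weight U S (insert x A)) / real (card (U - A))"
      using step assms(1) finite_subset[OF step.hyps assms(1)]
      by (intro average_mono step.IH) (auto simp: card_insert_if)
    also have "\<dots> \<le> chain_weight U S A"
      by (subst (2) chain_weight_rec) (use assms step in auto)
    finally show ?thesis .
  qed
qed

text \<open>A chain that passes a rarely continued set \<open>B\<close> has \<open>B\<close> as its
  last member of \<open>G\<close> with probability more than \<open>1 - \<eta>\<close>. Being last
  happens for at most one \<open>B\<close>, and only if the chain meets \<open>G\<close> at all. The
  induction carries out this count along the first step of the chain.\<close>

lemma chain_weight_rarely_continued:
  assumes "finite U" "A \<subseteq> U" "G \<subseteq> Pow U" "0 < \<eta>" "\<eta> < 1"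
  shows "(1 - \<eta>) * chain_weight U {B \<in> G. hit_above U G B < \<eta>} A \<le> hit U G A"
  using assms(1,2)
proof (induction A rule: superset_induct)
  case (step A)
  let ?D = "{B \<in> G. hit_above U G B < \<eta>}"
  have D: "?D \<subseteq> Pow U"
    using assms(3) by auto
  have "(1 - \<eta>) * ((\<Sum>x\<in>U - A. chain_weight U ?D (insert x A)) / real (card (U - A)))
      = (\<Sum>x\<in>U - A. (1 - \<eta>) * chain_weight U ?D (insert x A)) / real (card (U - A))"
    by (simp add: sum_distrib_left)
  also have "\<dots> \<le> hit_above U G A"
    unfolding hit_above_def[of U G A] using step by (intro average_mono) auto
  finally have avg: "(1 - \<eta>) * ((\<Sum>x\<in>U - A. chain_weight U ?D (insert x A)) / real (card (U - A)))
      \<le> hit_above U G A" .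
  have "(1 - \<eta>) * chain_weight U ?D A \<le> (1 - \<eta>) * of_bool (A \<in> ?D) + hit_above U G A"
    using avg chain_weight_rec[OF assms(1) step.hyps D] by (simp add: distrib_left)
  \<comment> \<open>If \<open>A\<close> is rarely continued, then \<open>hit_above\<close> is below
    \<open>\<eta>\<close> and the left side is at most 1; otherwise the indicator vanishes.\<close>
  also have "\<dots> \<le> hit U G A"
    using hit_above_bounds[OF assms(1) step.hyps, of G] by (auto simp: hit_eq assms(1))
  finally show ?case .
qed

text \<open>As in the LYM inequality: on a chain starting at the empty set every set is passed with
  probability at least the reciprocal of the middle binomial coefficient, while at most
  \<open>1 / (1 - \<eta>)\<close> rarely continued sets are expected.\<close>

lemma card_rarely_continued:
  assumes "finite U" "G \<subseteq> Pow U" "0 < \<eta>" "\<eta> < 1"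
  shows "real (card {B \<in> G. hit_above U G B < \<eta>})
     \<le> real (card U choose (card U div 2)) / (1 - \<eta>)"
proof -
  let ?D = "{B \<in> G. hit_above U G B < \<eta>}" and ?C = "real (card U choose (card U div 2))"
  have C: "?C > 0"
    by simp
  have "real (card ?D) / ?C = (\<Sum>B | B \<in> ?D \<and> {} \<subseteq> B. 1 / ?C)"
    by simp
  also have "\<dots> \<le> chain_weight U ?D {}"
    unfolding chain_weight_def
  proof (rule sum_mono)
    fix B assume "B \<in> {B. B \<in> ?D \<and> {} \<subseteq> B}"
    then have "card B \<le> card U"
      using assms by (intro card_mono) auto
    then show "1 / ?C \<le> 1 / real (card (U - {}) choose card (B - {}))"
      by (auto intro!: divide_left_mono simp: binomial_maximum)
  qed
  finally have "(1 - \<eta>) * (real (card ?D) / ?C) \<le> (1 - \<eta>) * chain_weight U ?D {}"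
    using assms by (intro mult_left_mono) auto
  also have "\<dots> \<le> 1"
    using chain_weight_rarely_continued[OF assms(1) _ assms(2-4), of "{}"]
      hit_bounds[OF assms(1), of "{}" G] by auto
  finally show ?thesis
    using C assms by (simp add: field_simps)
qed

section \<open>Rich sets\<close>

primrec rich :: "'b set \<Rightarrow> real \<Rightarrow> 'b set set \<Rightarrow> nat \<Rightarrow> 'b set set" where
  "rich U \<eta> F 0 = F"
| "rich U \<eta> F (Suc k) = {A \<in> rich U \<eta> F k. \<eta> \<le> hit_above U (rich U \<eta> F k) A}"

lemma rich_subset: "rich U \<eta> F k \<subseteq> F"
  by (induction k) auto

lemma card_rich:
  assumes "finite U" "F \<subseteq> Pow U" "0 < \<eta>" "\<eta> < 1"
  shows "real (card F) - real k * (real (card U choose (card U div 2)) / (1 - \<eta>))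
    \<le> real (card (rich U \<eta> F k))"
proof (induction k)
  case (Suc k)
  let ?G = "rich U \<eta> F k"
  have G: "?G \<subseteq> Pow U" "finite ?G"
    using rich_subset[of U \<eta> F k] assms(1,2) by (auto intro: finite_subset[of _ "Pow U"])
  have "?G = {B \<in> ?G. hit_above U ?G B < \<eta>} \<union> rich U \<eta> F (Suc k)"
    by auto
  then have "card ?G \<le> card {B \<in> ?G. hit_above U ?G B < \<eta>} + card (rich U \<eta> F (Suc k))"
    by (metis card_Un_le)
  then have "real (card ?G) \<le> real (card {B \<in> ?G. hit_above U ?G B < \<eta>}) + real (card (rich U \<eta> F (Suc k)))"
    by (metis of_nat_add of_nat_le_iff)
  with Suc card_rarely_continued[OF assms(1) G(1) assms(3,4)] show ?case
    by (simp add: algebra_simps add_divide_distrib)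
qed simp

text \<open>Apply the strong Markov property \<open>j\<close> times. Each application costs a factor
  \<open>\<eta>\<close> and moves to a strictly larger set, hence the distance of at least
  \<open>j\<close>. The bound is on the expected number of such sets, the form that counting
  needs.\<close>

lemma rich_chain_weight:
  assumes "finite U" "F \<subseteq> Pow U" "0 < \<eta>" and A: "A \<in> rich U \<eta> F (b + j)"
  shows "\<eta> ^ j \<le> chain_weight U {B \<in> rich U \<eta> F b. card A + j \<le> card B} A"
  using A
proof (induction j arbitrary: A)
  case 0
  then have "A \<subseteq> U"
    using rich_subset[of U \<eta> F b] assms by auto
  moreover have "{B \<in> rich U \<eta> F b. card A \<le> card B} \<subseteq> Pow U"
    using rich_subset[of U \<eta> F b] assms by auto
  ultimately show ?case
    using 0 assms(1) chain_weight_nonneg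
    by (subst chain_weight_rec) (auto intro!: divide_nonneg_nonneg sum_nonneg)
next
  case (Suc j)
  let ?G = "rich U \<eta> F (b + j)"
  let ?S = "{B \<in> rich U \<eta> F b. card A + Suc j \<le> card B}"
  have AU: "A \<subseteq> U"
    using Suc.prems rich_subset[of U \<eta> F "b + Suc j"] assms by auto
  have S: "?S \<subseteq> Pow U"
    using rich_subset[of U \<eta> F b] assms by auto
  have finF: "finite F"
    using assms(1,2) by (meson finite_Pow_iff finite_subset)
  \<comment> \<open>A rich set \<open>C\<close> strictly above \<open>A\<close> is at least one
    level higher, so distance \<open>j\<close> from \<open>C\<close> means distance at least
    \<open>Suc j\<close> from \<open>A\<close>.\<close>
  have C: "\<eta> ^ j \<le> chain_weight U ?S C" if "C \<in> ?G" "Suc (card A) \<le> card C" for C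
  proof -
    have "\<eta> ^ j \<le> chain_weight U {B \<in> rich U \<eta> F b. card C + j \<le> card B} C"
      using that(1) by (rule Suc.IH)
    also have "\<dots> \<le> chain_weight U ?S C"
      using that(2) finite_subset[OF rich_subset finF] by (intro chain_weight_mono) auto
    finally show ?thesis .
  qed
  have "\<eta> ^ Suc j \<le> \<eta> ^ j * hit_above U ?G A"
    using Suc.prems assms(3) by simp
  also have "\<dots> = (\<Sum>x\<in>U - A. \<eta> ^ j * hit U ?G (insert x A)) / real (card (U - A))"
    by (simp add: hit_above_def sum_distrib_left)
  also have "\<dots> \<le> (\<Sum>x\<in>U - A. chain_weight U ?S (insert x A)) / real (card (U - A))"
    using AU assms(1,3) C finite_subset[OF AU assms(1)]
    by (intro average_mono hit_le_chain_weight[OF assms(1) _ S, of _ _ _ "Suc (card A)"]) auto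
  also have "\<dots> \<le> chain_weight U ?S A"
    using chain_weight_rec[OF assms(1) AU S] by simp
  finally show ?case .
qed

section \<open>Counting rich sets above a given set\<close>

lemma binomial_ge_outer:
  assumes "k \<le> s" "k \<le> N - s" "s \<le> N"
  shows "N choose k \<le> N choose s"
\<comment> \<open>The hypotheses place \<open>s\<close> between \<open>k\<close> and
  \<open>N - k\<close>, so it is at least as central as \<open>k\<close>; past the middle,
  \<open>N - s\<close> is used in its place.\<close>
proof (cases "2 * s \<le> N")
  case True
  then show ?thesis
    using assms by (intro binomial_mono) auto
next
  case False
  then have "N choose k \<le> N choose (N - s)"
    using assms by (intro binomial_mono) auto
  then show ?thesis
    using assms by (simp add: binomial_symmetric[symmetric])
qed

text \<open>The expected number of suitable \<open>B\<close> on the chain is at least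
  \<open>\<eta> ^ j\<close>, while each contributes at most \<open>1 / (?N choose j)\<close>: its
  distance from \<open>A\<close> is at least \<open>j\<close>, and because \<open>card B\<close> is
  at most \<open>3 * n / 4\<close> and \<open>j\<close> at most \<open>n / 4\<close>, its distance
  from the top is at least \<open>j\<close> too. Hence there are at least
  \<open>\<eta> ^ j * (?N choose j)\<close> of them, of order \<open>n ^ j\<close>.\<close>

lemma card_rich_above:
  assumes F: "F \<subseteq> Pow {1..n}" "\<And>A. A \<in> F \<Longrightarrow> 4 * card A \<le> 3 * n"
    and \<eta>: "0 < \<eta>" "\<eta> < 1" and j: "1 \<le> j" "j \<le> h" "4 * h \<le> n"
    and A: "A \<in> rich {1..n} \<eta> F (b + j)"
  shows "(\<eta> / (4 * real h)) ^ h * real n ^ j \<le> real (card {B \<in> rich {1..n} \<eta> F b. A \<subseteq> B})"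
proof -
  let ?S = "{B \<in> rich {1..n} \<eta> F b. card A + j \<le> card B}"
  let ?N = "card ({1..n} - A)"
  have AF: "A \<in> F" "A \<subseteq> {1..n}"
    using A rich_subset[of "{1..n}" \<eta> F "b + j"] F(1) by auto
  have finA: "finite A"
    using AF finite_subset by blast
  have N: "?N = n - card A" "card A \<le> n"
    using AF finA card_mono[OF _ AF(2)] by (auto simp: card_Diff_subset)
  have N4: "n \<le> 4 * ?N"
    using N F(2)[OF AF(1)] by linarith
  have finF: "finite F"
    using F(1) by (meson finite_Pow_iff finite_atLeastAtMost finite_subset)
  have fin: "finite {B \<in> rich {1..n} \<eta> F b. A \<subseteq> B}"
    using finite_subset[OF rich_subset finF] by auto
  have NJ: "real (?N choose j) > 0"
    using N4 j by (simp add: zero_less_binomial_iff)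
  have "\<eta> ^ j \<le> chain_weight {1..n} ?S A"
    by (rule rich_chain_weight[OF _ F(1) \<eta>(1) A]) simp
  also have "\<dots> \<le> (\<Sum>B | B \<in> ?S \<and> A \<subseteq> B. 1 / real (?N choose j))"
    unfolding chain_weight_def
  proof (rule sum_mono)
    fix B assume B: "B \<in> {B. B \<in> ?S \<and> A \<subseteq> B}"
    then have BF: "B \<in> F" "B \<subseteq> {1..n}"
      using rich_subset[of "{1..n}" \<eta> F b] F(1) by auto
    then have finB: "finite B"
      using finite_subset by blast
    have BA: "card (B - A) = card B - card A"
      using B finA by (auto simp: card_Diff_subset)
    have "card B \<le> n"
      using card_mono[OF _ BF(2)] by simp
    then have "?N choose j \<le> ?N choose card (B - A)"
      using BA B N j F(2)[OF BF(1)] by (intro binomial_ge_outer) auto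
    then show "1 / real (?N choose card (B - A)) \<le> 1 / real (?N choose j)"
      using NJ by (intro frac_le) auto
  qed
  also have "\<dots> = real (card {B. B \<in> ?S \<and> A \<subseteq> B}) / real (?N choose j)"
    by simp
  finally have "\<eta> ^ j * real (?N choose j) \<le> real (card {B. B \<in> ?S \<and> A \<subseteq> B})"
    using NJ by (simp add: field_simps)
  also have "\<dots> \<le> real (card {B \<in> rich {1..n} \<eta> F b. A \<subseteq> B})"
    using fin by (intro of_nat_mono card_mono) auto
  finally have 1: "\<eta> ^ j * real (?N choose j) \<le> real (card {B \<in> rich {1..n} \<eta> F b. A \<subseteq> B})" .
  have "real n / 4 / real h \<le> real ?N / real j"
    using N4 j by (intro frac_le) auto
  then have "real n / (4 * real h) \<le> real ?N / real j"
    by simp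
  then have "(real n / (4 * real h)) ^ j \<le> (real ?N / real j) ^ j"
    by (intro power_mono) auto
  also have "\<dots> \<le> real (?N choose j)"
    using N4 j by (intro binomial_ge_n_over_k_pow_k) auto
  finally have 2: "(real n / (4 * real h)) ^ j \<le> real (?N choose j)" .
  \<comment> \<open>The base is at most 1, so the exponent \<open>h\<close> in place of
    \<open>j\<close> only lowers the bound and gives one constant for all \<open>j\<close>.\<close>
  have "\<eta> / (4 * real h) \<le> 1"
    using \<eta> j by (simp add: field_simps)
  then have "(\<eta> / (4 * real h)) ^ h \<le> (\<eta> / (4 * real h)) ^ j"
    using \<eta> j by (intro power_decreasing) auto
  then have "(\<eta> / (4 * real h)) ^ h * real n ^ j \<le> (\<eta> / (4 * real h)) ^ j * real n ^ j"
    by (intro mult_right_mono) auto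
  also have "\<dots> = \<eta> ^ j * (real n / (4 * real h)) ^ j"
    by (simp add: power_divide power_mult_distrib)
  also have "\<dots> \<le> \<eta> ^ j * real (?N choose j)"
    using 2 \<eta> by (intro mult_left_mono) auto
  finally show ?thesis
    using 1 by linarith
qed

text \<open>An exponential moment bound: give \<open>A\<close> the weight \<open>3 ^ card A\<close>.
  The total weight is \<open>4 ^ n\<close>, and a set with more than \<open>3 * n / 4\<close> points
  weighs at least \<open>(9 / 4) ^ n\<close>. So there are at most
  \<open>2 ^ n * (8 / 9) ^ n\<close> such sets, whereas the middle binomial coefficient is at least
  \<open>2 ^ n / (n + 1)\<close>.\<close>

lemma few_large_sets:
  fixes \<epsilon> :: real
  assumes "\<epsilon> > 0"
  shows "\<forall>\<^sub>F n in sequentially. real (card {A. A \<subseteq> {1..n} \<and> 3 * n < 4 * card A})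
    \<le> \<epsilon> * real (n choose (n div 2))"
proof -
  have "((\<lambda>n. (real n + 1) * (8 / 9) ^ n) \<longlongrightarrow> 0) sequentially"
    by real_asymp
  then have "\<forall>\<^sub>F n in sequentially. (real n + 1) * (8 / 9) ^ n < \<epsilon>"
    using assms by (rule order_tendstoD)
  then show ?thesis
  proof eventually_elim
    case (elim n)
    let ?S = "{A. A \<subseteq> {1..n} \<and> 3 * n < 4 * card A}"
    have "real (card ?S) * (9 / 4) ^ n = (\<Sum>A\<in>?S. (9 / 4) ^ n)"
      by simp
    also have "\<dots> \<le> (\<Sum>A\<in>?S. 3 ^ card A)"
    proof (rule sum_mono)
      fix A assume "A \<in> ?S"
      then have "3 * n \<le> 4 * card A"
        by auto
      \<comment> \<open>Fourth powers avoid the fractional exponent \<open>3 * n / 4\<close>; the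
        comparison rests on \<open>(9 / 4) ^ 4 \<le> 27\<close>.\<close>
      have "((9 / 4) ^ n) ^ 4 = ((9 / 4 :: real) ^ 4) ^ n"
        by (simp add: mult.commute flip: power_mult)
      also have "\<dots> \<le> (3 ^ 3) ^ n"
        by (intro power_mono) (auto simp: power_divide)
      also have "\<dots> = 3 ^ (3 * n)"
        by (simp add: power_mult)
      also have "\<dots> \<le> (3 :: real) ^ (4 * card A)"
        using \<open>3 * n \<le> 4 * card A\<close> by (intro power_increasing) auto
      also have "\<dots> = (3 ^ card A) ^ 4"
        by (simp add: mult.commute flip: power_mult)
      finally have "((9 / 4) ^ n) ^ 4 \<le> ((3 :: real) ^ card A) ^ 4" .
      moreover have "((3 :: real) ^ card A) ^ 4 < ((9 / 4) ^ n) ^ 4" if "(3 :: real) ^ card A < (9 / 4) ^ n"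
        using that by (intro power_strict_mono) auto
      ultimately show "(9 / 4) ^ n \<le> (3 :: real) ^ card A"
        by linarith
    qed
    also have "\<dots> \<le> (\<Sum>A\<in>Pow {1..n}. 3 ^ card A)"
      by (intro sum_mono2) auto
    \<comment> \<open>Expanding the product chooses 3 for the points of \<open>A\<close> and 1 for
      the others.\<close>
    also have "\<dots> = (\<Prod>x\<in>{1..n}. (3::real) + 1)"
      by (subst prod_add) auto
    also have "\<dots> = 2 ^ n * 2 ^ n"
      by (simp flip: power_mult_distrib)
    finally have 1: "real (card ?S) * (9 / 4) ^ n \<le> 2 ^ n * 2 ^ n" .
    have "(2::nat) ^ n = (\<Sum>k\<le>n. n choose k)"
      by (rule choose_row_sum[symmetric])
    also have "\<dots> \<le> (\<Sum>k\<le>n. n choose (n div 2))"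
      by (intro sum_mono binomial_maximum)
    also have "\<dots> = (n + 1) * (n choose (n div 2))"
      by simp
    finally have "real (2 ^ n) \<le> real ((n + 1) * (n choose (n div 2)))"
      by (rule of_nat_mono)
    then have 2: "2 ^ n \<le> (real n + 1) * real (n choose (n div 2))"
      by (simp add: algebra_simps)
    have "real (card ?S) * (9 / 4) ^ n \<le> 2 ^ n * ((real n + 1) * real (n choose (n div 2)))"
      by (rule order_trans[OF 1 mult_left_mono[OF 2]]) simp
    then have "real (card ?S) \<le> 2 ^ n * ((real n + 1) * real (n choose (n div 2))) / (9 / 4) ^ n"
      by (subst pos_le_divide_eq) auto
    also have "\<dots> = (real n + 1) * (2 ^ n / (9 / 4) ^ n) * real (n choose (n div 2))"
      by simp
    also have "2 ^ n / (9 / 4) ^ n = (8 / 9 :: real) ^ n"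
      by (simp flip: power_divide)
    also have "(real n + 1) * (8 / 9) ^ n * real (n choose (n div 2)) \<le> \<epsilon> * real (n choose (n div 2))"
      using elim by (intro mult_right_mono) auto
    finally show ?case .
  qed
qed

section \<open>Rooted tree posets\<close>

lemma partial_order_on_subset: "partial_order_on T r \<Longrightarrow> r \<subseteq> T \<times> T"
  by (simp add: partial_order_on_def preorder_on_def)

lemma partial_order_on_refl: "partial_order_on T r \<Longrightarrow> v \<in> T \<Longrightarrow> (v, v) \<in> r"
  by (simp add: partial_order_on_def preorder_on_def refl_on_def)

lemma partial_order_on_trans:
  "partial_order_on T r \<Longrightarrow> (u, v) \<in> r \<Longrightarrow> (v, w) \<in> r \<Longrightarrow> (u, w) \<in> r"
  unfolding partial_order_on_def preorder_on_def by (meson transD)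

lemma partial_order_on_antisym:
  "partial_order_on T r \<Longrightarrow> (u, v) \<in> r \<Longrightarrow> (v, u) \<in> r \<Longrightarrow> u = v"
  unfolding partial_order_on_def by (meson antisymD)

text \<open>A finite tree order with its root at the bottom, given by a parent map: below a vertex
  lie only the vertex itself and what is below its parent. The value of \<open>par\<close> at
  \<open>root\<close> is left open.\<close>

locale rooted_tree_order =
  fixes T :: "'a set" and r :: "'a rel" and root :: 'a and par :: "'a \<Rightarrow> 'a"
  assumes finite_T: "finite T" and order: "partial_order_on T r"
    and root_in: "root \<in> T"
    and below_root: "(u, root) \<in> r \<longleftrightarrow> u = root"
    and par_in: "v \<in> T \<Longrightarrow> v \<noteq> root \<Longrightarrow> par v \<in> T"
    and par_neq: "v \<in> T \<Longrightarrow> v \<noteq> root \<Longrightarrow> par v \<noteq> v"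
    and below_par: "v \<in> T \<Longrightarrow> v \<noteq> root \<Longrightarrow> (u, v) \<in> r \<longleftrightarrow> u = v \<or> (u, par v) \<in> r"
begin

definition down :: "'a \<Rightarrow> 'a set" where
  "down v = {u. (u, v) \<in> r}"

definition depth :: "'a \<Rightarrow> nat" where
  "depth v = card (down v)"

abbreviation height :: nat where
  "height \<equiv> poset_height T r"

definition inner :: "'a \<Rightarrow> bool" where
  "inner v \<longleftrightarrow> v \<in> par ` (T - {root})"

text \<open>
  In \<open>height\<close> consecutive levels the extremal copy puts every inner vertex as low and every
  leaf as high as possible; \<open>wt v\<close> is then the number of levels from \<open>par v\<close> up to \<open>v\<close>,
  and \<open>rank v\<close> the number of levels above \<open>v\<close>.
\<close>

definition wt :: "'a \<Rightarrow> nat" where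
  "wt v = (if inner v then 1 else height + 1 - depth v)"

definition rank :: "'a \<Rightarrow> nat" where
  "rank v = (if v = root \<or> inner v then height - depth v else 0)"

text \<open>This will be x(T): in the extremal copy the edge from \<open>par v\<close> to
  \<open>v\<close> adds \<open>wt v\<close> points, and different edges add disjoint sets.\<close>

definition width :: nat where
  "width = (\<Sum>v\<in>T - {root}. wt v)"

lemmas r_subset = partial_order_on_subset[OF order]
lemmas r_refl = partial_order_on_refl[OF order]
lemmas r_trans = partial_order_on_trans[OF order]
lemmas r_antisym = partial_order_on_antisym[OF order]

lemma par_below: "v \<in> T \<Longrightarrow> v \<noteq> root \<Longrightarrow> (par v, v) \<in> r"
  using below_par par_in r_refl by blast

lemma down_subset: "down v \<subseteq> T"
  using r_subset by (auto simp: down_def)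

lemma finite_down: "finite (down v)"
  using down_subset finite_T finite_subset by blast

lemma down_root: "down root = {root}"
  by (auto simp: down_def below_root)

lemma depth_root [simp]: "depth root = 1"
  by (simp add: depth_def down_root)

lemma down_par:
  assumes "v \<in> T" "v \<noteq> root"
  shows "down v = insert v (down (par v))" "v \<notin> down (par v)"
  using below_par[OF assms] par_below[OF assms] par_neq[OF assms] r_antisym
  by (auto simp: down_def)

lemma depth_par: "v \<in> T \<Longrightarrow> v \<noteq> root \<Longrightarrow> depth v = Suc (depth (par v))"
  using down_par finite_down by (simp add: depth_def)

lemma tree_induct [consumes 1, case_names root par]:
  assumes "v \<in> T" "P root"
    and "\<And>v. v \<in> T \<Longrightarrow> v \<noteq> root \<Longrightarrow> P (par v) \<Longrightarrow> P v"
  shows "P v"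
  using assms(1)
proof (induction "depth v" arbitrary: v rule: less_induct)
  case less
  show ?case
  proof (cases "v = root")
    case False
    then have "depth (par v) < depth v"
      using depth_par[OF less.prems] by simp
    then show ?thesis
      using less False par_in assms(3) by blast
  qed (use assms(2) in simp)
qed

lemma root_below: "v \<in> T \<Longrightarrow> (root, v) \<in> r"
proof (induction rule: tree_induct)
  case (par v)
  then show ?case
    using r_trans par_below by blast
qed (simp add: r_refl root_in)

lemma down_chain:
  assumes "v \<in> T"
  shows "down v \<in> Chains r"
  using assms
proof (induction rule: tree_induct)
  case root
  then show ?case
    using r_refl[OF root_in] by (simp add: down_root Chains_def)
next
  case (par v)
  have "(u, v) \<in> r" if "u \<in> down (par v)" for u
    using that down_par(1)[OF par(1,2)] unfolding down_def by blast
  moreover have "(v, v) \<in> r"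
    using par(1) by (rule r_refl)
  ultimately show ?case
    using par(3) by (simp add: down_par(1)[OF par(1,2)] Chains_def)
qed

lemma depth_le_height:
  assumes "v \<in> T"
  shows "depth v \<le> height"
proof -
  have "finite (card ` {C. C \<subseteq> T \<and> C \<in> Chains r})"
    using finite_T by simp
  then have "finite {card C |C. C \<subseteq> T \<and> C \<in> Chains r}"
    by (simp only: setcompr_eq_image)
  moreover have "depth v \<in> {card C |C. C \<subseteq> T \<and> C \<in> Chains r}"
    unfolding depth_def using down_chain[OF assms] down_subset[of v]
    by (intro CollectI exI[of _ "down v"] conjI refl)
  ultimately show ?thesis
    unfolding poset_height_def by (rule Max_ge)
qed

lemma height_pos: "0 < height"
  using depth_le_height[OF root_in] by simp

lemma inner_par: "v \<in> T \<Longrightarrow> v \<noteq> root \<Longrightarrow> inner (par v)"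
  by (auto simp: inner_def)

lemma rank_root: "rank root = height - 1"
  by (simp add: rank_def)

text \<open>The identity that links the weights to rich sets: along an edge,
  \<open>card_rich_above\<close> is applied with \<open>b = rank v\<close> and
  \<open>j = wt v\<close>.\<close>

lemma rank_par: "v \<in> T \<Longrightarrow> v \<noteq> root \<Longrightarrow> rank (par v) = rank v + wt v"
  using depth_par[of v] depth_le_height[of v] inner_par[of v]
  by (auto simp: rank_def wt_def)

lemma rank_le: "v \<in> T \<Longrightarrow> rank v \<le> height - 1"
proof (induction rule: tree_induct)
  case (par v)
  then show ?case
    using rank_par[of v] by simp
qed (simp add: rank_root)

lemma wt_pos: "v \<in> T \<Longrightarrow> 1 \<le> wt v"
  using depth_le_height[of v] by (auto simp: wt_def)

lemma wt_le: "v \<in> T \<Longrightarrow> v \<noteq> root \<Longrightarrow> wt v \<le> height"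
  using depth_par[of v] height_pos by (simp add: wt_def)

lemma sum_wt_down:
  assumes "v \<in> T"
  shows "(\<Sum>u\<in>down v - {root}. wt u) = height - 1 - rank v"
  using assms
proof (induction rule: tree_induct)
  case root
  then show ?case
    by (simp add: down_root rank_root)
next
  case (par v)
  have "down v - {root} = insert v (down (par v) - {root})" "v \<notin> down (par v) - {root}"
    using down_par[OF par(1,2)] par(2) by auto
  then have "(\<Sum>u\<in>down v - {root}. wt u) = wt v + (height - 1 - rank (par v))"
    using par(3) finite_down by simp
  then show ?case
    using rank_par[OF par(1,2)] rank_le[OF par_in[OF par(1,2)]] by simp
qed

subsection \<open>The number x(T)\<close>

text \<open>The intersection of a copy is the image of the root, and its union adds the increments
  along the edges. An increment is 1 plus the change in slack, that is, in height above the lowest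
  possible level. The slack of an inner vertex is gained on the edge below it and lost again on some
  edge above it, so only the slack of leaves survives.\<close>

lemma copy_spread_le:
  assumes "G \<in> copies T r (consecutive_levels n i height)"
  shows "card (\<Union>G) - card (\<Inter>G) \<le> width"
proof -
  obtain f where f: "bij_betw f T G" "monotone_on T (\<lambda>p q. (p, q) \<in> r) (\<subseteq>) f"
    and G: "G \<subseteq> consecutive_levels n i height"
    using assms unfolding copies_def by blast
  have G_eq: "G = f ` T"
    using bij_betw_imp_surj_on[OF f(1)] by (rule sym)
  have mono: "f u \<subseteq> f v" if "(u, v) \<in> r" for u v
    using f(2) that r_subset by (auto simp: monotone_on_def)
  have fin: "finite (f v)" if "v \<in> T" for v
    using G that finite_subset[of "f v" "{1..n}"] by (auto simp: G_eq consecutive_levels_def)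
  have lev: "i + 1 \<le> int (card (f v))" "int (card (f v)) \<le> i + int height" if "v \<in> T" for v
    using G that by (auto simp: G_eq consecutive_levels_def)
  have less: "f (par v) \<subset> f v" if "v \<in> T" "v \<noteq> root" for v
    using mono[OF par_below[OF that]] par_neq[OF that] par_in[OF that] that(1) f(1)
    by (auto simp: bij_betw_def inj_on_def)
  have low: "i + int (depth v) \<le> int (card (f v))" if "v \<in> T" for v
    using that
  proof (induction rule: tree_induct)
    case (par v)
    then show ?case
      using psubset_card_mono[OF fin[OF par(1)] less[OF par(1,2)]] depth_par[OF par(1,2)]
      by simp
  qed (use lev[OF root_in] in simp)
  \<comment> \<open>The slack of \<open>v\<close>: level \<open>i + depth v\<close> is the lowest
    that it can occupy.\<close>
  define s where "s v = int (card (f v)) - i - int (depth v)" for v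
  have s_nonneg: "0 \<le> s v" if "v \<in> T" for v
    using low[OF that] by (simp add: s_def)
  let ?V = "T - {root}"
  have "f v \<subseteq> f root \<union> (\<Union>u\<in>?V. f u - f (par u))" if "v \<in> T" for v
    using that by (induction rule: tree_induct) auto
  then have "\<Union>G \<subseteq> f root \<union> (\<Union>u\<in>?V. f u - f (par u))"
    by (auto simp: G_eq)
  then have "card (\<Union>G) \<le> card (f root \<union> (\<Union>u\<in>?V. f u - f (par u)))"
    using fin root_in finite_T by (intro card_mono) auto
  also have "\<dots> \<le> card (f root) + (\<Sum>u\<in>?V. card (f u - f (par u)))"
    using card_Un_le[of "f root" "\<Union>u\<in>?V. f u - f (par u)"]
      card_UN_le[of ?V "\<lambda>u. f u - f (par u)"] finite_T by simp
  finally have "int (card (\<Union>G)) \<le> int (card (f root)) + (\<Sum>u\<in>?V. int (card (f u - f (par u))))"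
    by (simp only: of_nat_le_iff flip: of_nat_add of_nat_sum)
  also have "(\<Sum>u\<in>?V. int (card (f u - f (par u)))) = (\<Sum>u\<in>?V. 1 + s u - s (par u))"
  proof (rule sum.cong)
    fix u assume u: "u \<in> ?V"
    then have "card (f u - f (par u)) = card (f u) - card (f (par u))" "card (f (par u)) \<le> card (f u)"
      using fin[OF par_in] fin less by (auto intro!: card_Diff_subset card_mono)
    then show "int (card (f u - f (par u))) = 1 + s u - s (par u)"
      using depth_par[of u] u by (simp add: s_def)
  qed simp
  also have "\<dots> = (\<Sum>u\<in>?V. 1 + s u) - (\<Sum>u\<in>?V. s (par u))"
    by (simp add: sum_subtractf)
  \<comment> \<open>Every inner vertex other than the root is the parent of at least one vertex, so
    its slack is subtracted at least once.\<close>
  also have "\<dots> \<le> (\<Sum>u\<in>?V. 1 + s u) - (\<Sum>u\<in>?V. if inner u then s u else 0)"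
  proof -
    have "(\<Sum>u\<in>?V. if inner u then s u else 0) = sum s (?V \<inter> par ` ?V)"
      using finite_T by (simp add: sum.inter_restrict inner_def)
    also have "\<dots> \<le> sum s (par ` ?V)"
      using finite_T s_nonneg par_in by (intro sum_mono2) auto
    also have "\<dots> \<le> sum (s \<circ> par) ?V"
      using finite_T s_nonneg par_in by (intro sum_image_le) auto
    finally show ?thesis
      by simp
  qed
  also have "\<dots> = (\<Sum>u\<in>?V. 1 + s u - (if inner u then s u else 0))"
    by (simp add: sum_subtractf)
  also have "\<dots> \<le> (\<Sum>u\<in>?V. int (wt u))"
  proof (rule sum_mono)
    fix u assume "u \<in> ?V"
    then show "1 + s u - (if inner u then s u else 0) \<le> int (wt u)"
      using lev(2)[of u] depth_le_height[of u] by (auto simp: s_def wt_def)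
  qed
  also have "\<dots> = int width"
    by (simp add: width_def)
  finally have "int (card (\<Union>G)) \<le> int (card (f root)) + int width"
    by simp
  moreover have "\<Inter>G = f root"
    using mono[OF root_below] root_in by (auto simp: G_eq)
  ultimately show ?thesis
    by simp
qed

text \<open>The root becomes \<open>{1..k}\<close> on the lowest level of the window, every other
  vertex \<open>v\<close> gets its own block of \<open>wt v\<close> fresh points, and the image of
  \<open>v\<close> collects the blocks on the path from the root to \<open>v\<close>.\<close>

lemma ex_copy_spread:
  assumes "0 \<le> i" "i + 1 + int width \<le> int n"
  shows "\<exists>G\<in>copies T r (consecutive_levels n i height). card (\<Union>G) - card (\<Inter>G) = width"
proof -
  let ?V = "T - {root}"
  let ?D = "SIGMA v:?V. {..<wt v}"
  define k where "k = nat i + 1"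
  have k: "int k = i + 1" "k + width \<le> n"
    using assms by (auto simp: k_def)
  have finD: "finite ?D"
    using finite_T by auto
  have "card ?D = width"
    using finite_T by (simp add: width_def)
  then have "card ?D \<le> card {k + 1..n}"
    using k by simp
  with finD have "\<exists>e. e ` ?D \<subseteq> {k + 1..n} \<and> inj_on e ?D"
    by (intro card_le_inj) simp_all
  \<comment> \<open>\<open>e\<close> names the fresh points: the pairs \<open>(v, a)\<close> with
    \<open>a < wt v\<close> form the block of \<open>v\<close>.\<close>
  then obtain e where e: "e ` ?D \<subseteq> {k + 1..n}" "inj_on e ?D"
    by (elim exE conjE)
  let ?E = "\<lambda>v. SIGMA u:down v - {root}. {..<wt u}"
  define f where "f v = {1..k} \<union> e ` ?E v" for v
  have ED: "?E v \<subseteq> ?D" for v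
    using down_subset by auto
  have e_range: "e ` ?E v \<subseteq> {k + 1..n}" for v
    using e(1) image_mono[OF ED[of v], of e] by (rule order_trans[rotated])
  have root_f: "f root = {1..k}"
    by (simp add: f_def down_root)
  have card_f: "card (f v) = k + (height - 1 - rank v)" if "v \<in> T" for v
  proof -
    have "{1..k} \<inter> {k + 1..n} = {}"
      by auto
    then have "{1..k} \<inter> e ` ?E v = {}"
      using e_range[of v] by blast
    then have "card (f v) = k + card (e ` ?E v)"
      unfolding f_def using finite_subset[OF e_range[of v]]
      by (subst card_Un_disjoint) auto
    also have "card (e ` ?E v) = card (?E v)"
      using e(2) ED by (meson card_image inj_on_subset)
    also have "\<dots> = (\<Sum>u\<in>down v - {root}. wt u)"
      using finite_down by simp
    finally show ?thesis
      using sum_wt_down[OF that] by simp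
  qed
  have mono: "f u \<subseteq> f v" if "(u, v) \<in> r" for u v
  proof -
    have "?E u \<subseteq> ?E v"
      using that r_trans by (auto simp: down_def)
    then show ?thesis
      by (auto simp: f_def)
  qed
  \<comment> \<open>Blocks are nonempty, so the point \<open>e (u, 0)\<close> of the image of
    \<open>u\<close> can lie in the image of \<open>v\<close> only if \<open>u\<close> is below
    \<open>v\<close>. Thus \<open>f\<close> reflects the order and is injective.\<close>
  have below: "(u, v) \<in> r" if "f u \<subseteq> f v" "u \<in> T" "v \<in> T" for u v
  proof (cases "u = root")
    case False
    have u: "(u, 0) \<in> ?E u"
      using that(2) False wt_pos[of u] r_refl by (auto simp: down_def)
    then have "e (u, 0) \<in> f v" "e (u, 0) \<notin> {1..k}"
      using that(1) e_range[of u] by (force simp: f_def)+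
    then have "e (u, 0) \<in> e ` ?E v"
      unfolding f_def by blast
    then have "(u, 0) \<in> ?E v"
      using e(2) ED[of v] ED[of u] u by (meson inj_on_image_mem_iff subsetD)
    then show ?thesis
      by (simp add: down_def)
  qed (use that root_below in simp)
  have inj: "inj_on f T"
  proof (rule inj_onI)
    fix u v assume "u \<in> T" "v \<in> T" "f u = f v"
    then show "u = v"
      using below[of u v] below[of v u] r_antisym[of u v] by simp
  qed
  let ?G = "f ` T"
  have "?G \<subseteq> consecutive_levels n i height"
  proof clarify
    fix v assume v: "v \<in> T"
    have "{1..k} \<subseteq> {1..n}" "{k + 1..n} \<subseteq> {1..n}"
      using k by auto
    then have "f v \<subseteq> {1..n}"
      unfolding f_def using e_range[of v] by blast
    then show "f v \<in> consecutive_levels n i height"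
      using card_f[OF v] k height_pos by (simp add: consecutive_levels_def)
  qed
  moreover have "bij_betw f T ?G"
    using inj by (simp add: bij_betw_def)
  moreover have "monotone_on T (\<lambda>p q. (p, q) \<in> r) (\<subseteq>) f"
    using mono by (auto simp: monotone_on_def)
  ultimately have "?G \<in> copies T r (consecutive_levels n i height)"
    by (auto simp: copies_def)
  moreover have "\<Inter>?G = {1..k}"
    using mono[OF root_below] root_in by (auto simp: root_f)
  moreover have "\<Union>?G = {1..k} \<union> e ` ?D"
  proof -
    have "?D \<subseteq> (\<Union>v\<in>T. ?E v)"
      using r_refl by (auto simp: down_def)
    then have "?D = (\<Union>v\<in>T. ?E v)"
      using ED by blast
    then show ?thesis
      using root_in by (auto simp: f_def)
  qed
  moreover have "card ({1..k} \<union> e ` ?D) = k + width"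
  proof -
    have "{1..k} \<inter> {k + 1..n} = {}"
      by auto
    then have "{1..k} \<inter> e ` ?D = {}"
      using e(1) by blast
    then show ?thesis
      using finD \<open>card ?D = width\<close> card_image[OF e(2)] by (subst card_Un_disjoint) auto
  qed
  ultimately show ?thesis
    by (intro bexI[of _ ?G]) simp_all
qed

subsection \<open>Counting embeddings\<close>

text \<open>Here \<open>L k\<close> will be the family of k-rich sets. Inclusion is required only
  along edges, since it spreads by transitivity; extensionality makes a map determined by its values
  on \<open>S\<close>, so that maps can be counted.\<close>

definition embeddings :: "(nat \<Rightarrow> 'b set set) \<Rightarrow> 'a set \<Rightarrow> ('a \<Rightarrow> 'b set) set" where
  "embeddings L S = {g \<in> extensional S. inj_on g S \<and> (\<forall>v\<in>S. g v \<in> L (rank v)) \<and>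
     (\<forall>v\<in>S - {root}. g (par v) \<subseteq> g v)}"

lemma finite_embeddings:
  assumes "\<And>k. finite (L k)" "finite S"
  shows "finite (embeddings L S)"
  using assms
  by (intro finite_subset[OF _ finite_PiE[of S "\<lambda>v. L (rank v)"]])
    (auto simp: embeddings_def PiE_def)

text \<open>The vertices are placed one by one, parents first, and \<open>S\<close> is the part
  placed so far. The extra \<open>card T\<close> in the hypothesis pays for the sets already used,
  so each placement keeps at least \<open>c * q ^ wt v\<close> choices.\<close>

lemma card_embeddings_ge:
  fixes L :: "nat \<Rightarrow> 'b set set" and c q :: real
  assumes fin: "\<And>k. finite (L k)" and c: "c \<ge> 0" "q \<ge> 0"
    and above: "\<And>v A. v \<in> T \<Longrightarrow> v \<noteq> root \<Longrightarrow> A \<in> L (rank (par v)) \<Longrightarrow>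
      c * q ^ wt v + real (card T) \<le> real (card {B \<in> L (rank v). A \<subseteq> B})"
    and S: "S \<subseteq> T" "root \<in> S" "\<And>v. v \<in> S \<Longrightarrow> v \<noteq> root \<Longrightarrow> par v \<in> S"
  shows "real (card (L (height - 1))) * (\<Prod>v\<in>S - {root}. c * q ^ wt v)
    \<le> real (card (embeddings L S))"
  using S
proof (induction "card S" arbitrary: S rule: less_induct)
  case less
  have finS: "finite S"
    using less.prems(1) finite_T finite_subset by blast
  show ?case
  proof (cases "S = {root}")
    case True
    let ?g = "\<lambda>B. \<lambda>v\<in>{root}. B"
    have "?g ` L (height - 1) \<subseteq> embeddings L S"
      by (auto simp: embeddings_def True rank_root)
    moreover have "inj_on ?g (L (height - 1))"
      by (rule inj_onI) (metis restrict_apply singletonI)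
    ultimately have "card (L (height - 1)) \<le> card (embeddings L S)"
      using finite_embeddings[OF fin finS] by (meson card_inj_on_le)
    then show ?thesis
      by (simp add: True)
  next
    case False
    then have "depth ` (S - {root}) \<noteq> {}"
      using less.prems(2) by auto
    \<comment> \<open>A deepest vertex of \<open>S\<close> is nobody's parent within
      \<open>S\<close> and can be removed.\<close>
    then have "Max (depth ` (S - {root})) \<in> depth ` (S - {root})"
      using finS by (intro Max_in) auto
    then obtain v where "v \<in> S - {root}" and v_max: "Max (depth ` (S - {root})) = depth v"
      by (rule imageE)
    then have v: "v \<in> S" "v \<noteq> root"
      by auto
    have vmax: "depth u \<le> depth v" if "u \<in> S" "u \<noteq> root" for u
      using that finS by (simp flip: v_max)
    have vT: "v \<in> T"
      using v less.prems by auto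
    let ?S = "S - {v}"
    have par_S: "par u \<in> ?S" if "u \<in> S" "u \<noteq> root" for u
    proof -
      have "depth (par u) < depth u"
        using depth_par[of u] that less.prems(1) by auto
      then show ?thesis
        using vmax[OF that] less.prems(3)[OF that] by auto
    qed
    have IH: "real (card (L (height - 1))) * (\<Prod>u\<in>?S - {root}. c * q ^ wt u)
        \<le> real (card (embeddings L ?S))"
    proof (rule less.hyps)
      show "card ?S < card S"
        using v(1) finS by (meson card_Diff1_less)
      show "?S \<subseteq> T" "root \<in> ?S"
        using less.prems v by auto
      show "par u \<in> ?S" if "u \<in> ?S" "u \<noteq> root" for u
        using that par_S by auto
    qed
    define ext where "ext g = {B \<in> L (rank v). g (par v) \<subseteq> B} - g ` ?S" for g :: "'a \<Rightarrow> 'b set"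
    have finE: "finite (embeddings L ?S)"
      using fin finS by (intro finite_embeddings) auto
    have finX: "finite (ext g)" for g
      using fin[of "rank v"] by (simp add: ext_def)
    have card_ext: "c * q ^ wt v \<le> real (card (ext g))" if "g \<in> embeddings L ?S" for g
    proof -
      have "g (par v) \<in> L (rank (par v))"
        using that par_S[OF v(1,2)] by (simp add: embeddings_def)
      from above[OF vT v(2) this]
      have "c * q ^ wt v + real (card T) \<le> real (card {B \<in> L (rank v). g (par v) \<subseteq> B})" .
      moreover have "card {B \<in> L (rank v). g (par v) \<subseteq> B} - card (g ` ?S) \<le> card (ext g)"
        unfolding ext_def using finS by (intro diff_card_le_card_Diff) auto
      moreover have "card (g ` ?S) \<le> card T"
        using card_image_le[of ?S g] card_mono[OF finite_T, of ?S] finS less.prems(1) by force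
      ultimately show ?thesis
        by linarith
    qed
    \<comment> \<open>No information is lost: \<open>B\<close> is the value at \<open>v\<close>,
      where \<open>g\<close> itself is undefined by extensionality.\<close>
    let ?f = "\<lambda>(g, B). g(v := B)"
    have "inj_on ?f (Sigma (embeddings L ?S) ext)"
    proof (rule inj_onI, clarify)
      fix g B g' B'
      assume g: "g \<in> embeddings L ?S" "g' \<in> embeddings L ?S" and eq: "g(v := B) = g'(v := B')"
      have "g u = g' u" for u
      proof (cases "u = v")
        case True
        then show ?thesis
          using g by (simp add: embeddings_def extensional_def)
      next
        case False
        then show ?thesis
          using fun_cong[OF eq, of u] by simp
      qed
      then show "g = g' \<and> B = B'"
        using fun_cong[OF eq, of v] by auto
    qed
    moreover have "?f ` Sigma (embeddings L ?S) ext \<subseteq> embeddings L S"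
    proof clarify
      fix g B
      assume g: "g \<in> embeddings L ?S" and B: "B \<in> ext g"
      have "inj_on (g(v := B)) S"
        using g B by (auto simp: embeddings_def ext_def inj_on_def)
      moreover have "g(v := B) \<in> extensional S"
        using g v(1) by (auto simp: embeddings_def extensional_def)
      moreover have "(g(v := B)) u \<in> L (rank u)" if "u \<in> S" for u
        using g B that by (auto simp: embeddings_def ext_def)
      moreover have "(g(v := B)) (par u) \<subseteq> (g(v := B)) u" if "u \<in> S - {root}" for u
        using g B that par_S[of u] by (auto simp: embeddings_def ext_def)
      ultimately show "g(v := B) \<in> embeddings L S"
        by (simp add: embeddings_def)
    qed
    ultimately have "card (Sigma (embeddings L ?S) ext) \<le> card (embeddings L S)"
      using finite_embeddings[OF fin finS] by (meson card_inj_on_le)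
    then have le: "(\<Sum>g\<in>embeddings L ?S. real (card (ext g))) \<le> real (card (embeddings L S))"
      using finE finX by (simp add: card_SigmaI flip: of_nat_sum)
    have "S - {root} = insert v (?S - {root})"
      using v by auto
    then have "(\<Prod>u\<in>S - {root}. c * q ^ wt u) = c * q ^ wt v * (\<Prod>u\<in>?S - {root}. c * q ^ wt u)"
      using finS by simp
    then have "real (card (L (height - 1))) * (\<Prod>u\<in>S - {root}. c * q ^ wt u)
        \<le> real (card (embeddings L ?S)) * (c * q ^ wt v)"
      using mult_right_mono[OF IH, of "c * q ^ wt v"] c by (simp add: mult_ac)
    also have "\<dots> = (\<Sum>g\<in>embeddings L ?S. c * q ^ wt v)"
      by simp
    also have "\<dots> \<le> (\<Sum>g\<in>embeddings L ?S. real (card (ext g)))"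
      by (intro sum_mono card_ext)
    finally show ?thesis
      using le by linarith
  qed
qed

text \<open>The image of an embedding is a copy, and one copy is the image of at most
  \<open>card T ^ card T\<close> maps.\<close>

lemma card_embeddings_le_copies:
  fixes F :: "nat set set"
  assumes F: "finite F" "\<And>k. L k \<subseteq> F"
  shows "card (embeddings L T) \<le> card (copies T r F) * card T ^ card T"
proof -
  have "copies T r F \<subseteq> Pow F"
    by (auto simp: copies_def)
  then have fin: "finite (copies T r F)"
    using F(1) by (meson finite_Pow_iff finite_subset)
  have G: "finite G \<and> card G = card T" if "G \<in> copies T r F" for G
  proof -
    obtain i where "bij_betw i T G"
      using \<open>G \<in> copies T r F\<close> unfolding copies_def by blast
    then show ?thesis
      using finite_T by (auto simp: bij_betw_finite bij_betw_same_card)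
  qed
  have "embeddings L T \<subseteq> (\<Union>G\<in>copies T r F. PiE T (\<lambda>_. G))"
  proof
    fix g assume g: "g \<in> embeddings L T"
    have mono: "g u \<subseteq> g v" if "v \<in> T" "(u, v) \<in> r" for u v
      using that
    proof (induction rule: tree_induct)
      case root
      then show ?case
        by (simp add: below_root)
    next
      case (par v)
      have "u = v \<or> g u \<subseteq> g (par v)"
        using par(3,4) below_par[OF par(1,2)] by blast
      moreover have "g (par v) \<subseteq> g v"
        using g par(1,2) by (simp add: embeddings_def)
      ultimately show ?case
        by blast
    qed
    have "g ` T \<in> copies T r F"
      unfolding copies_def
    proof (intro CollectI conjI exI)
      show "g ` T \<subseteq> F"
        using g F(2) by (auto simp: embeddings_def)
      show "bij_betw g T (g ` T)"
        using g by (simp add: embeddings_def bij_betw_def)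
      show "monotone_on T (\<lambda>p q. (p, q) \<in> r) (\<subseteq>) g"
        using mono by (simp add: monotone_on_def)
    qed
    moreover have "g \<in> PiE T (\<lambda>_. g ` T)"
      using g by (auto simp: embeddings_def PiE_def)
    ultimately show "g \<in> (\<Union>G\<in>copies T r F. PiE T (\<lambda>_. G))"
      by blast
  qed
  moreover have "finite (\<Union>G\<in>copies T r F. PiE T (\<lambda>_. G))"
    using fin G finite_T by (intro finite_UN_I finite_PiE) auto
  ultimately have "card (embeddings L T) \<le> card (\<Union>G\<in>copies T r F. PiE T (\<lambda>_. G))"
    by (intro card_mono)
  also have "\<dots> \<le> (\<Sum>G\<in>copies T r F. card (PiE T (\<lambda>_. G)))"
    using fin by (rule card_UN_le)
  also have "\<dots> = (\<Sum>G\<in>copies T r F. card T ^ card T)"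
    using G finite_T by (intro sum.cong) (auto simp: card_PiE)
  finally show ?thesis
    by simp
qed

lemma card_copies_ge:
  assumes "\<epsilon> > 0"
  shows "\<exists>\<delta>>0. \<exists>n0. \<forall>n\<ge>n0. \<forall>F. F \<subseteq> Pow {1..n} \<longrightarrow>
    real (card F) \<ge> (real height - 1 + \<epsilon>) * real (n choose (n div 2)) \<longrightarrow>
    real (card (copies T r F)) \<ge> \<delta> * real n ^ width * real (n choose (n div 2))"
proof -
  define h where "h = height"
  have h: "1 \<le> h"
    using height_pos by (simp add: h_def)
  \<comment> \<open>Both \<open>\<eta> * h\<close> and \<open>\<epsilon> * \<eta> / 4\<close> are
    then at most \<open>\<epsilon> / 8\<close>, which gives
    \<open>(h - 1) / (1 - \<eta>) \<le> h - 1 + \<epsilon> / 4\<close>.\<close>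
  define \<eta> where "\<eta> = min (1 / 2) (\<epsilon> / (8 * real h))"
  have \<eta>: "0 < \<eta>" "\<eta> \<le> 1 / 2" "\<eta> * real h \<le> \<epsilon> / 8"
  proof -
    have "\<eta> * real h \<le> \<epsilon> / (8 * real h) * real h"
      by (intro mult_right_mono) (auto simp: \<eta>_def)
    then show "\<eta> * real h \<le> \<epsilon> / 8"
      using h by simp
  qed (use assms h in \<open>auto simp: \<eta>_def\<close>)
  \<comment> \<open>Half the constant of \<open>card_rich_above\<close>; the other half absorbs
    \<open>card T\<close> once \<open>card T \<le> c * n\<close>.\<close>
  define c where "c = (\<eta> / (4 * real h)) ^ h / 2"
  have c: "c > 0"
    using \<eta>(1) h by (simp add: c_def)
  have T0: "0 < card T"
    using finite_T root_in by (simp add: card_gt_0_iff) blast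
  define d where "d = real (card T) ^ card T"
  have d: "d > 0"
    using T0 by (simp add: d_def)
  \<comment> \<open>Of \<open>\<epsilon>\<close>, one quarter goes to the large sets and one quarter
    to the loss in the rich families, leaving \<open>\<epsilon> / 2\<close> for the root. Each edge
    contributes a factor \<open>c\<close>, and \<open>d\<close> corrects for maps with the same
    image.\<close>
  define \<delta> where "\<delta> = \<epsilon> / 2 * c ^ card (T - {root}) / d"
  have "\<delta> > 0"
    using assms c d by (simp add: \<delta>_def)
  obtain n1 where n1: "\<And>n. n \<ge> n1 \<Longrightarrow>
      real (card {A. A \<subseteq> {1..n} \<and> 3 * n < 4 * card A}) \<le> \<epsilon> / 4 * real (n choose (n div 2))"
    using few_large_sets[of "\<epsilon> / 4"] assms by (auto simp: eventually_sequentially)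
  define n0 where "n0 = max n1 (max (4 * h) (nat \<lceil>real (card T) / c\<rceil>))"
  have main: "\<delta> * real n ^ width * real (n choose (n div 2)) \<le> real (card (copies T r F))"
    if n: "n \<ge> n0" and F: "F \<subseteq> Pow {1..n}"
      and big: "(real h - 1 + \<epsilon>) * real (n choose (n div 2)) \<le> real (card F)" for n F
  proof -
    let ?C = "real (n choose (n div 2))"
    have n': "n \<ge> n1" "4 * h \<le> n" "real (card T) / c \<le> real n"
      using n by (auto simp: n0_def)
    have nT: "real (card T) \<le> c * real n"
      using n'(3) c by (simp add: field_simps)
    have finF: "finite F"
      using F by (meson finite_Pow_iff finite_atLeastAtMost finite_subset)
    \<comment> \<open>Without the sets above level \<open>3 * n / 4\<close>,
      \<open>card_rich_above\<close> applies.\<close>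
    define F0 where "F0 = {A \<in> F. 4 * card A \<le> 3 * n}"
    have F0: "F0 \<subseteq> Pow {1..n}" "F0 \<subseteq> F"
      using F by (auto simp: F0_def)
    have "card F \<le> card (F0 \<union> {A. A \<subseteq> {1..n} \<and> 3 * n < 4 * card A})"
      using F finite_subset[OF F0(2) finF] by (intro card_mono) (auto simp: F0_def)
    also have "\<dots> \<le> card F0 + card {A. A \<subseteq> {1..n} \<and> 3 * n < 4 * card A}"
      by (rule card_Un_le)
    finally have "real (card F) \<le> real (card F0) + \<epsilon> / 4 * ?C"
      using n1[OF n'(1)] by linarith
    with big have cF0: "(real h - 1 + \<epsilon>) * ?C \<le> real (card F0) + \<epsilon> / 4 * ?C"
      by linarith
    let ?L = "rich {1..n} \<eta> F0"
    have "real (card F0) - real (h - 1) * (?C / (1 - \<eta>)) \<le> real (card (?L (h - 1)))"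
      using card_rich[OF _ F0(1), of \<eta> "h - 1"] \<eta> by simp
    moreover have "real (h - 1) * (?C / (1 - \<eta>)) \<le> (real h - 1 + \<epsilon> / 4) * ?C"
    proof -
      have "\<epsilon> * \<eta> \<le> \<epsilon> * (1 / 2)"
        using \<eta>(2) assms by (intro mult_left_mono) auto
      moreover have "(real h - 1 + \<epsilon> / 4) * (1 - \<eta>)
          = real h - 1 + \<epsilon> / 4 - \<eta> * real h + \<eta> - \<epsilon> * \<eta> / 4"
        by (simp add: field_simps)
      ultimately have "real h - 1 \<le> (real h - 1 + \<epsilon> / 4) * (1 - \<eta>)"
        using \<eta> assms by linarith
      then have "(real h - 1) / (1 - \<eta>) \<le> real h - 1 + \<epsilon> / 4"
        using \<eta>(2) by (simp add: field_simps)
      then show ?thesis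
        using mult_right_mono[of "(real h - 1) / (1 - \<eta>)" "real h - 1 + \<epsilon> / 4" ?C] h by simp
    qed
    ultimately have root_choices: "\<epsilon> / 2 * ?C \<le> real (card (?L (h - 1)))"
      using cF0 by (simp add: algebra_simps)
    have finL: "finite (?L k)" for k
      by (rule finite_subset[OF subset_trans[OF rich_subset F0(2)] finF])
    have above: "c * real n ^ wt v + real (card T) \<le> real (card {B \<in> ?L (rank v). A \<subseteq> B})"
      if "v \<in> T" "v \<noteq> root" "A \<in> ?L (rank (par v))" for v A
    proof -
      have "2 * c * real n ^ wt v \<le> real (card {B \<in> ?L (rank v). A \<subseteq> B})"
        unfolding c_def
      proof (simp only: times_divide_eq_right nonzero_mult_div_cancel_left zero_neq_numeral
          not_False_eq_True, rule card_rich_above[OF F0(1)])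
        show "4 * card A \<le> 3 * n" if "A \<in> F0" for A
          using that by (simp add: F0_def)
        show "wt v \<le> h"
          using wt_le[OF that(1,2)] by (simp add: h_def)
        show "A \<in> ?L (rank v + wt v)"
          using that(3) rank_par[OF that(1,2)] by simp
      qed (use \<eta> n'(2) wt_pos[OF that(1)] in auto)
      moreover have "real (card T) \<le> c * real n ^ wt v"
      proof -
        have "real n ^ 1 \<le> real n ^ wt v"
          using wt_pos[OF that(1)] n'(2) h by (intro power_increasing) auto
        then have "c * real n \<le> c * real n ^ wt v"
          using c by simp
        then show ?thesis
          using nT by linarith
      qed
      ultimately show ?thesis
        by linarith
    qed
    have "\<epsilon> / 2 * ?C * (c ^ card (T - {root}) * real n ^ width) =
        \<epsilon> / 2 * ?C * (\<Prod>v\<in>T - {root}. c * real n ^ wt v)"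
      by (simp add: prod.distrib power_sum width_def)
    also have "\<dots> \<le> real (card (?L (h - 1))) * (\<Prod>v\<in>T - {root}. c * real n ^ wt v)"
      using root_choices c by (intro mult_right_mono prod_nonneg) auto
    also have "\<dots> \<le> real (card (embeddings ?L T))"
      unfolding h_def using c root_in par_in
      by (intro card_embeddings_ge finL above) auto
    also have "\<dots> \<le> real (card (copies T r F) * card T ^ card T)"
      using card_embeddings_le_copies[OF finF, of ?L] subset_trans[OF rich_subset F0(2)]
      by (intro of_nat_mono) blast
    also have "\<dots> = real (card (copies T r F)) * d"
      by (simp add: d_def)
    finally show ?thesis
      using d by (simp add: \<delta>_def field_simps)
  qed
  show ?thesis
  proof (intro exI[of _ \<delta>] exI[of _ n0] conjI allI impI)
    show "\<delta> > 0"
      by fact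
  qed (rule main[unfolded h_def])
qed

end

section \<open>Upward monotone tree posets as rooted trees\<close>

lemma obtain_max:
  fixes f :: "'b \<Rightarrow> nat"
  assumes "finite S" "S \<noteq> {}"
  obtains y where "y \<in> S" "\<And>z. z \<in> S \<Longrightarrow> f z \<le> f y"
proof -
  have "Max (f ` S) \<in> f ` S"
    using assms by (intro Max_in) auto
  then obtain y where "y \<in> S" "f y = Max (f ` S)"
    by auto
  with assms that show thesis
    by simp
qed

lemma ex_lower_cover:
  assumes "finite T" "partial_order_on T r" "(u, v) \<in> r" "u \<noteq> v"
  obtains y where "hasse_arc r y v" "(u, y) \<in> r"
proof -
  note sub = partial_order_on_subset[OF assms(2)] and refl = partial_order_on_refl[OF assms(2)]
    and trans = partial_order_on_trans[OF assms(2)] and antisym = partial_order_on_antisym[OF assms(2)]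
  let ?S = "{z. (u, z) \<in> r \<and> (z, v) \<in> r \<and> z \<noteq> v}"
  let ?D = "\<lambda>z. {w. (w, z) \<in> r}"
  have "?S \<subseteq> T" "u \<in> ?S"
    using assms sub refl by auto
  then have S: "finite ?S" "?S \<noteq> {}"
    using finite_subset[OF _ assms(1)] by auto
  \<comment> \<open>An element strictly between \<open>y\<close> and \<open>v\<close> would have a
    larger down-set, so \<open>y\<close> with the largest down-set is covered by
    \<open>v\<close>.\<close>
  obtain y where y: "y \<in> ?S" and ymax: "\<And>z. z \<in> ?S \<Longrightarrow> card (?D z) \<le> card (?D y)"
    using obtain_max[OF S, of "\<lambda>z. card (?D z)"] by blast
  have False if "(y, z) \<in> r" "y \<noteq> z" "(z, v) \<in> r" "z \<noteq> v" for z
  proof -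
    have "z \<in> ?S"
      using y that trans by blast
    have "finite (?D z)"
      using sub assms(1) by (intro finite_subset[of "?D z" T]) auto
    moreover have "?D y \<subset> ?D z"
    proof
      show "?D y \<subseteq> ?D z"
        using that(1) trans by blast
      have "z \<in> ?D z" "z \<notin> ?D y"
        using that(1,2) sub refl antisym by blast+
      then show "?D y \<noteq> ?D z"
        by blast
    qed
    ultimately have "card (?D y) < card (?D z)"
      by (rule psubset_card_mono)
    with ymax[OF \<open>z \<in> ?S\<close>] show False
      by simp
  qed
  then have "hasse_arc r y v"
    using y unfolding hasse_arc_def by blast
  with y that show thesis
    by blast
qed

text \<open>Take a minimal element and walk through the connected Hasse diagram. Every vertex
  reached stays above it: a step down from \<open>x\<close> must lead to the only lower cover of
  \<open>x\<close>, and some lower cover lies above the minimal element. The parent is this unique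
  lower cover.\<close>

lemma upward_monotone_rooted:
  assumes "tree_poset T r" "upward_monotone T r"
  obtains root par where "rooted_tree_order T r root par"
proof -
  have fin: "finite T" and po: "partial_order_on T r" and ne: "T \<noteq> {}"
    and conn: "\<And>u v. u \<in> T \<Longrightarrow> v \<in> T \<Longrightarrow> (hasse_edge r)\<^sup>*\<^sup>* u v"
    using assms(1) by (auto simp: tree_poset_def finite_poset_def undirected_tree_def)
  note sub = partial_order_on_subset[OF po] and refl = partial_order_on_refl[OF po]
    and trans = partial_order_on_trans[OF po] and antisym = partial_order_on_antisym[OF po]
  have unique: "y = z" if "hasse_arc r y x" "hasse_arc r z x" for x y z
  proof -
    have "x \<in> T" "y \<in> T" "z \<in> T"
      using that sub by (auto simp: hasse_arc_def)
    then have "\<exists>\<^sub>\<le>\<^sub>1 y. y \<in> T \<and> hasse_arc r y x"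
      using assms(2) by (simp add: upward_monotone_def)
    then show ?thesis
      using that \<open>y \<in> T\<close> \<open>z \<in> T\<close> by (auto dest: Uniq_D)
  qed
  let ?U = "\<lambda>z. {w. (z, w) \<in> r}"
  \<comment> \<open>A largest up-set forces \<open>m\<close> to be minimal.\<close>
  obtain m where m: "m \<in> T" and mmax: "\<And>z. z \<in> T \<Longrightarrow> card (?U z) \<le> card (?U m)"
    using obtain_max[OF fin ne, of "\<lambda>z. card (?U z)"] by blast
  have minimal: "u = m" if "(u, m) \<in> r" for u
  proof (rule ccontr)
    assume "u \<noteq> m"
    have "finite (?U u)"
      using sub fin by (intro finite_subset[of "?U u" T]) auto
    moreover have "?U m \<subset> ?U u"
    proof
      show "?U m \<subseteq> ?U u"
        using that trans by blast
      have "u \<in> ?U u" "u \<notin> ?U m"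
        using that \<open>u \<noteq> m\<close> sub refl antisym by blast+
      then show "?U m \<noteq> ?U u"
        by blast
    qed
    ultimately have "card (?U m) < card (?U u)"
      by (rule psubset_card_mono)
    moreover have "u \<in> T"
      using that sub by auto
    ultimately show False
      using mmax[of u] by simp
  qed
  have root_below: "(m, v) \<in> r" if "v \<in> T" for v
    using conn[OF m that]
  proof (induction rule: rtranclp_induct)
    case base
    show ?case
      using m by (rule refl)
  next
    case (step x y)
    show ?case
    proof (cases "hasse_arc r x y")
      case True
      then show ?thesis
        using step.IH trans unfolding hasse_arc_def by blast
    next
      case False
      then have arc: "hasse_arc r y x"
        using step.hyps by (simp add: hasse_edge_def)
      then have "m \<noteq> x"
        using minimal by (auto simp: hasse_arc_def)
      with ex_lower_cover[OF fin po step.IH] obtain z where "hasse_arc r z x" "(m, z) \<in> r"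
        by blast
      then show ?thesis
        using unique arc by blast
    qed
  qed
  define par where "par v = (SOME y. hasse_arc r y v)" for v
  have par: "hasse_arc r (par v) v" if v: "v \<in> T" "v \<noteq> m" for v
  proof -
    obtain y where "hasse_arc r y v"
      using ex_lower_cover[OF fin po root_below[OF v(1)]] v(2) by blast
    then show ?thesis
      unfolding par_def by (rule someI)
  qed
  have "rooted_tree_order T r m par"
  proof
    show "(u, m) \<in> r \<longleftrightarrow> u = m" for u
      using minimal refl m by blast
    fix v assume v: "v \<in> T" "v \<noteq> m"
    show "par v \<in> T" "par v \<noteq> v"
      using par[OF v] sub by (auto simp: hasse_arc_def)
    show "(u, v) \<in> r \<longleftrightarrow> u = v \<or> (u, par v) \<in> r" for u
    proof
      assume "(u, v) \<in> r"
      show "u = v \<or> (u, par v) \<in> r"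
      proof (cases "u = v")
        case False
        then obtain y where "hasse_arc r y v" "(u, y) \<in> r"
          using ex_lower_cover[OF fin po \<open>(u, v) \<in> r\<close>] by blast
        then show ?thesis
          using unique par[OF v] by blast
      qed simp
    next
      assume "u = v \<or> (u, par v) \<in> r"
      then show "(u, v) \<in> r"
        using par[OF v] refl v trans unfolding hasse_arc_def by blast
    qed
  qed (use fin po m in auto)
  then show thesis
    by (rule that)
qed

section \<open>Complementation\<close>

lemma copies_mono: "F \<subseteq> F' \<Longrightarrow> copies T r F \<subseteq> copies T r F'"
  by (auto simp: copies_def)

lemma copies_subset: "G \<in> copies T r F \<Longrightarrow> G \<subseteq> F"
  by (simp add: copies_def)

lemma finite_copies: "finite F \<Longrightarrow> finite (copies T r F)"
  using copies_subset by (metis Pow_iff finite_Pow_iff finite_subset subsetI)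

lemma inj_on_complement: "inj_on (\<lambda>A. U - A) (Pow U)"
  by (rule inj_onI) (metis Pow_iff double_diff subset_refl)

lemma complement_complement: "F \<subseteq> Pow U \<Longrightarrow> (\<lambda>A. U - A) ` (\<lambda>A. U - A) ` F = F"
proof -
  assume "F \<subseteq> Pow U"
  then have "(\<lambda>A. U - (U - A)) ` F = (\<lambda>A. A) ` F"
    by (intro image_cong) auto
  then show ?thesis
    by (simp add: image_image)
qed

lemma copies_complement:
  assumes "F \<subseteq> Pow U" "G \<in> copies T r F"
  shows "(\<lambda>A. U - A) ` G \<in> copies T (r\<inverse>) ((\<lambda>A. U - A) ` F)"
proof -
  obtain i where i: "bij_betw i T G" "monotone_on T (\<lambda>p q. (p, q) \<in> r) (\<subseteq>) i" and G: "G \<subseteq> F"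
    using assms(2) unfolding copies_def by blast
  have "inj_on (\<lambda>A. U - A) G"
    using inj_on_complement G assms(1) by (meson inj_on_subset subset_trans)
  then have "bij_betw (\<lambda>A. U - A) G ((\<lambda>A. U - A) ` G)"
    by (simp add: bij_betw_def)
  with i(1) have "bij_betw ((\<lambda>A. U - A) \<circ> i) T ((\<lambda>A. U - A) ` G)"
    by (rule bij_betw_trans)
  moreover have "monotone_on T (\<lambda>p q. (p, q) \<in> r\<inverse>) (\<subseteq>) ((\<lambda>A. U - A) \<circ> i)"
    using i(2) unfolding monotone_on_def by (metis Diff_mono comp_apply converse_iff subset_refl)
  ultimately show ?thesis
    unfolding copies_def using G by blast
qed

lemma poset_height_converse: "poset_height T (r\<inverse>) = poset_height T r"
proof -
  have "Chains (r\<inverse>) = Chains r"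
    by (auto simp: Chains_def)
  then show ?thesis
    by (simp add: poset_height_def)
qed

lemma consecutive_levels_subset: "consecutive_levels n i m \<subseteq> Pow {1..n}"
  by (auto simp: consecutive_levels_def)

lemma consecutive_levels_complement:
  "(\<lambda>A. {1..n} - A) ` consecutive_levels n i m \<subseteq> consecutive_levels n (int n - i - int m - 1) m"
proof clarify
  fix A assume A: "A \<in> consecutive_levels n i m"
  then have "A \<subseteq> {1..n}"
    by (simp add: consecutive_levels_def)
  then have "card ({1..n} - A) = n - card A" "card A \<le> n"
    using card_Diff_subset[of A "{1..n}"] card_mono[of "{1..n}" A] finite_subset by auto
  then show "{1..n} - A \<in> consecutive_levels n (int n - i - int m - 1) m"
    using A by (auto simp: consecutive_levels_def)
qed

text \<open>By De Morgan the union and the intersection trade places, and \<open>n\<close>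
  cancels.\<close>

lemma spread_complement:
  fixes G :: "nat set set"
  assumes "G \<subseteq> Pow {1..n}" "G \<noteq> {}"
  shows "card (\<Union>((\<lambda>A. {1..n} - A) ` G)) - card (\<Inter>((\<lambda>A. {1..n} - A) ` G)) =
    card (\<Union>G) - card (\<Inter>G)"
proof -
  have union: "\<Union>((\<lambda>A. {1..n} - A) ` G) = {1..n} - \<Inter>G"
    and inter: "\<Inter>((\<lambda>A. {1..n} - A) ` G) = {1..n} - \<Union>G"
    using assms by auto
  have card: "card ({1..n} - X) = n - card X" "card X \<le> n" if "X \<subseteq> {1..n}" for X
    using that card_mono[OF _ that] finite_subset[OF that] by (auto simp: card_Diff_subset)
  have "\<Inter>G \<subseteq> {1..n}" "\<Union>G \<subseteq> {1..n}"
    using assms by auto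
  from card[OF this(1)] card[OF this(2)] show ?thesis
    unfolding union inter by arith
qed

text \<open>
  The middle levels are not invariant under complementation when \<open>n - k\<close> is odd; the
  extremal spread is therefore stated for all windows of \<open>poset_height T r\<close> levels, with
  a condition on the window that is invariant.
\<close>

definition spread_attained :: "'a set \<Rightarrow> 'a rel \<Rightarrow> nat \<Rightarrow> bool" where
  "spread_attained T r x \<longleftrightarrow> (\<forall>n i. int x \<le> i \<longrightarrow> i + int (poset_height T r) + 1 + int x \<le> int n \<longrightarrow>
     (\<exists>G\<in>copies T r (consecutive_levels n i (poset_height T r)). card (\<Union>G) - card (\<Inter>G) = x))"

definition spread_bounded :: "'a set \<Rightarrow> 'a rel \<Rightarrow> nat \<Rightarrow> bool" where
  "spread_bounded T r x \<longleftrightarrow> (\<forall>n i. \<forall>G\<in>copies T r (consecutive_levels n i (poset_height T r)).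
     card (\<Union>G) - card (\<Inter>G) \<le> x)"

definition supersaturated :: "'a set \<Rightarrow> 'a rel \<Rightarrow> nat \<Rightarrow> bool" where
  "supersaturated T r x \<longleftrightarrow> (\<forall>\<epsilon>>0. \<exists>\<delta>>0. \<exists>n0. \<forall>n\<ge>n0. \<forall>F. F \<subseteq> Pow {1..n} \<longrightarrow>
     real (card F) \<ge> (real (poset_height T r) - 1 + \<epsilon>) * real (n choose (n div 2)) \<longrightarrow>
     real (card (copies T r F)) \<ge> \<delta> * real n ^ x * real (n choose (n div 2)))"

lemma copies_complement_levels:
  assumes "T \<noteq> {}" "G \<in> copies T r (consecutive_levels n i m)"
  shows "(\<lambda>A. {1..n} - A) ` G \<in> copies T (r\<inverse>) (consecutive_levels n (int n - i - int m - 1) m)"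
    and "card (\<Union>((\<lambda>A. {1..n} - A) ` G)) - card (\<Inter>((\<lambda>A. {1..n} - A) ` G)) =
      card (\<Union>G) - card (\<Inter>G)"
proof -
  show "(\<lambda>A. {1..n} - A) ` G \<in> copies T (r\<inverse>) (consecutive_levels n (int n - i - int m - 1) m)"
    using copies_complement[OF consecutive_levels_subset assms(2)]
      copies_mono[OF consecutive_levels_complement] by blast
  have "G \<subseteq> Pow {1..n}"
    using copies_subset[OF assms(2)] consecutive_levels_subset by blast
  moreover have "G \<noteq> {}"
  proof -
    obtain f where "bij_betw f T G"
      using assms(2) unfolding copies_def by blast
    then show ?thesis
      using bij_betw_imp_surj_on assms(1) by blast
  qed
  ultimately show "card (\<Union>((\<lambda>A. {1..n} - A) ` G)) - card (\<Inter>((\<lambda>A. {1..n} - A) ` G)) =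
      card (\<Union>G) - card (\<Inter>G)"
    by (rule spread_complement)
qed

lemma spread_bounded_converse:
  assumes "T \<noteq> {}" "spread_bounded T (r\<inverse>) x"
  shows "spread_bounded T r x"
  unfolding spread_bounded_def
proof (intro allI ballI)
  fix n i G assume "G \<in> copies T r (consecutive_levels n i (poset_height T r))"
  then show "card (\<Union>G) - card (\<Inter>G) \<le> x"
    using copies_complement_levels[OF assms(1)] assms(2)
    unfolding spread_bounded_def poset_height_converse by metis
qed

lemma spread_attained_converse:
  assumes "T \<noteq> {}" "spread_attained T (r\<inverse>) x"
  shows "spread_attained T r x"
  unfolding spread_attained_def
proof (intro allI impI)
  fix n i assume i: "int x \<le> i" "i + int (poset_height T r) + 1 + int x \<le> int n"
  let ?h = "poset_height T r"
  let ?j = "int n - i - int ?h - 1"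
  have "int x \<le> ?j" "?j + int ?h + 1 + int x \<le> int n"
    using i by auto
  then obtain G where G: "G \<in> copies T (r\<inverse>) (consecutive_levels n ?j ?h)"
    "card (\<Union>G) - card (\<Inter>G) = x"
    using assms(2) unfolding spread_attained_def poset_height_converse by blast
  have "int n - ?j - int ?h - 1 = i"
    by simp
  then have "(\<lambda>A. {1..n} - A) ` G \<in> copies T r (consecutive_levels n i ?h)"
    using copies_complement_levels(1)[OF assms(1) G(1)] by simp
  then show "\<exists>G\<in>copies T r (consecutive_levels n i ?h). card (\<Union>G) - card (\<Inter>G) = x"
    using copies_complement_levels(2)[OF assms(1) G(1)] G(2) by (intro bexI) auto
qed

lemma card_copies_complement:
  assumes "finite U" "F \<subseteq> Pow U"
  shows "card (copies T (r\<inverse>) ((\<lambda>A. U - A) ` F)) \<le> card (copies T r F)"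
proof -
  let ?c = "\<lambda>A. U - A"
  have sub: "copies T (r\<inverse>) (?c ` F) \<subseteq> Pow (Pow U)"
    using copies_subset[of _ T "r\<inverse>" "?c ` F"] by blast
  have "inj_on (image ?c) (Pow (Pow U))"
    by (intro inj_onI) (metis complement_complement Pow_iff)
  then have "inj_on (image ?c) (copies T (r\<inverse>) (?c ` F))"
    using sub by (rule inj_on_subset)
  moreover have "image ?c ` copies T (r\<inverse>) (?c ` F) \<subseteq> copies T r F"
  proof clarify
    fix G assume "G \<in> copies T (r\<inverse>) (?c ` F)"
    then have "?c ` G \<in> copies T ((r\<inverse>)\<inverse>) (?c ` ?c ` F)"
      by (intro copies_complement) auto
    then show "?c ` G \<in> copies T r F"
      unfolding complement_complement[OF assms(2)] by simp
  qed
  moreover have "finite F"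
    using assms by (meson finite_Pow_iff finite_subset)
  ultimately show ?thesis
    using finite_copies by (intro card_inj_on_le) auto
qed

lemma supersaturated_converse:
  assumes "supersaturated T (r\<inverse>) x"
  shows "supersaturated T r x"
  unfolding supersaturated_def
proof (intro allI impI)
  fix \<epsilon> :: real assume "\<epsilon> > 0"
  with assms[unfolded supersaturated_def poset_height_converse]
  have "\<exists>\<delta>>0. \<exists>n0. \<forall>n\<ge>n0. \<forall>F. F \<subseteq> Pow {1..n} \<longrightarrow>
     real (card F) \<ge> (real (poset_height T r) - 1 + \<epsilon>) * real (n choose (n div 2)) \<longrightarrow>
     real (card (copies T (r\<inverse>) F)) \<ge> \<delta> * real n ^ x * real (n choose (n div 2))"
    by (elim allE[of _ \<epsilon>] impE)
  then obtain \<delta> n0 where "\<delta> > 0" and *: "\<forall>n\<ge>n0. \<forall>F. F \<subseteq> Pow {1..n} \<longrightarrow>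
     real (card F) \<ge> (real (poset_height T r) - 1 + \<epsilon>) * real (n choose (n div 2)) \<longrightarrow>
     real (card (copies T (r\<inverse>) F)) \<ge> \<delta> * real n ^ x * real (n choose (n div 2))"
    by (elim exE conjE)
  show "\<exists>\<delta>>0. \<exists>n0. \<forall>n\<ge>n0. \<forall>F. F \<subseteq> Pow {1..n} \<longrightarrow>
     real (card F) \<ge> (real (poset_height T r) - 1 + \<epsilon>) * real (n choose (n div 2)) \<longrightarrow>
     real (card (copies T r F)) \<ge> \<delta> * real n ^ x * real (n choose (n div 2))"
  proof (intro exI[of _ \<delta>] exI[of _ n0] conjI allI impI)
    fix n F assume n: "n \<ge> n0" and F: "F \<subseteq> Pow {1..n}"
      and big: "real (card F) \<ge> (real (poset_height T r) - 1 + \<epsilon>) * real (n choose (n div 2))"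
    let ?F = "(\<lambda>A. {1..n} - A) ` F"
    have "card ?F = card F"
      using inj_on_subset[OF inj_on_complement F] by (rule card_image)
    moreover have "?F \<subseteq> Pow {1..n}"
      by auto
    ultimately have "real (card (copies T (r\<inverse>) ?F)) \<ge> \<delta> * real n ^ x * real (n choose (n div 2))"
      using n big by (intro *[rule_format]) simp_all
    also have "real (card (copies T (r\<inverse>) ?F)) \<le> real (card (copies T r F))"
      using card_copies_complement[OF _ F, of T r] by (intro of_nat_mono) simp
    finally show "real (card (copies T r F)) \<ge> \<delta> * real n ^ x * real (n choose (n div 2))" .
  qed (rule \<open>\<delta> > 0\<close>)
qed

section \<open>The values of e(T) and x(T)\<close>

lemma e_number_eq:
  assumes "finite_poset T r" "T \<noteq> {}" "spread_attained T r x"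
  shows "e_number T r = poset_height T r - 1" "0 < poset_height T r"
proof -
  let ?h = "poset_height T r"
  let ?K = "{C. C \<subseteq> T \<and> C \<in> Chains r}"
  have fin: "finite T" and po: "partial_order_on T r"
    using assms(1) by (auto simp: finite_poset_def)
  have h_eq: "?h = Max (card ` ?K)"
    by (simp add: poset_height_def setcompr_eq_image)
  have finK: "finite (card ` ?K)"
    using fin by simp
  obtain t where "t \<in> T"
    using assms(2) by blast
  then have t: "{t} \<in> ?K"
    using partial_order_on_refl[OF po] by (auto simp: Chains_def)
  then have "card {t} \<le> ?h"
    unfolding h_eq using finK by (intro Max_ge imageI t)
  then show h_pos: "0 < ?h"
    by simp
  have "?h \<in> card ` ?K"
    unfolding h_eq using finK t by (intro Max_in) auto
  then obtain C where C: "C \<subseteq> T" "C \<in> Chains r" "card C = ?h"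
    by auto
  have free: "poset_free T r (consecutive_levels n i (?h - 1))" for n i
    unfolding poset_free_def
  proof (rule equals0I)
    fix G assume "G \<in> copies T r (consecutive_levels n i (?h - 1))"
    then obtain f where f: "bij_betw f T G" "monotone_on T (\<lambda>p q. (p, q) \<in> r) (\<subseteq>) f"
      and G: "G \<subseteq> consecutive_levels n i (?h - 1)"
      unfolding copies_def by blast
    have fT: "f v \<in> consecutive_levels n i (?h - 1)" if "v \<in> T" for v
      using bij_betw_apply[OF f(1) that] G by blast
    have finf: "finite (f v)" if "v \<in> T" for v
      using fT[OF that] consecutive_levels_subset[of n i "?h - 1"] finite_subset[of "f v" "{1..n}"]
      by auto
    \<comment> \<open>The images of a longest chain are nested and distinct, so they occupy
      \<open>?h\<close> different levels, one more than the window has.\<close>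
    have inj: "inj_on (\<lambda>v. int (card (f v))) C"
    proof (rule inj_onI)
      fix u v assume uv: "u \<in> C" "v \<in> C" "int (card (f u)) = int (card (f v))"
      then have T: "u \<in> T" "v \<in> T"
        using C(1) by auto
      have "(u, v) \<in> r \<or> (v, u) \<in> r"
        using C(2) uv by (auto simp: Chains_def)
      then have "f u \<subseteq> f v \<or> f v \<subseteq> f u"
        using f(2) T by (auto simp: monotone_on_def)
      then have "f u = f v"
        using uv(3) T finf by (metis card_subset_eq of_nat_eq_iff)
      then show "u = v"
        using f(1) T by (auto simp: bij_betw_def inj_on_def)
    qed
    have "(\<lambda>v. int (card (f v))) ` C \<subseteq> {i + 1..i + int (?h - 1)}"
      using fT C(1) by (force simp: consecutive_levels_def)
    from card_inj_on_le[OF inj this] have "card C \<le> card {i + 1..i + int (?h - 1)}"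
      by blast
    then show False
      using C(3) h_pos by simp
  qed
  have "m \<le> ?h - 1" if m: "\<forall>n i. poset_free T r (consecutive_levels n i m)" for m
  proof (rule ccontr)
    assume "\<not> m \<le> ?h - 1"
    then have "consecutive_levels n i ?h \<subseteq> consecutive_levels n i m" for n i
      by (auto simp: consecutive_levels_def)
    \<comment> \<open>The offset \<open>x\<close> and \<open>n = 2 * x + ?h + 1\<close> are the
      smallest values that the conditions of \<open>spread_attained\<close> admit.\<close>
    moreover have "int x \<le> int x" "int x + int ?h + 1 + int x \<le> int (2 * x + ?h + 1)"
      by auto
    then obtain G where "G \<in> copies T r (consecutive_levels (2 * x + ?h + 1) (int x) ?h)"
      using assms(3) unfolding spread_attained_def by blast
    ultimately show False
      using m copies_mono unfolding poset_free_def by blast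
  qed
  with free show "e_number T r = ?h - 1"
    unfolding e_number_def by (intro Greatest_equality) auto
qed

lemma x_number_eq:
  assumes "finite_poset T r" "T \<noteq> {}" "spread_attained T r x" "spread_bounded T r x"
  shows "x_number T r = x"
proof -
  let ?h = "poset_height T r"
  have e: "e_number T r + 1 = ?h"
    using e_number_eq[OF assms(1-3)] by simp
  \<comment> \<open>For these \<open>n\<close> the half difference \<open>(n - ?h) / 2\<close> is at
    least \<open>x + 1\<close>, so the middle window satisfies both conditions of
    \<open>spread_attained\<close> whichever way the floor rounds.\<close>
  have at: "x_number_at T r n = x" if n: "n \<ge> 2 * x + ?h + 2" for n
  proof -
    let ?i = "\<lfloor>(real n - real ?h) / 2\<rfloor>"
    let ?M = "consecutive_levels n ?i ?h"
    have n': "2 * real x + real ?h + 2 \<le> real n"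
      using n by linarith
    have "int x \<le> ?i"
      using n' by (simp add: le_floor_iff)
    moreover have "real_of_int (?i + int ?h + 1 + int x) \<le> real_of_int (int n)"
      using n' of_int_floor_le[of "(real n - real ?h) / 2"] by simp
    then have "?i + int ?h + 1 + int x \<le> int n"
      by (simp only: of_int_le_iff)
    ultimately obtain G where G: "G \<in> copies T r ?M" "card (\<Union>G) - card (\<Inter>G) = x"
      using assms(3) unfolding spread_attained_def by blast
    have "finite ?M"
      using consecutive_levels_subset[of n ?i ?h] by (rule finite_subset) simp
    then have "finite ((\<lambda>G. card (\<Union>G) - card (\<Inter>G)) ` copies T r ?M)"
      using finite_copies by blast
    moreover have "y \<le> x" if "y \<in> (\<lambda>G. card (\<Union>G) - card (\<Inter>G)) ` copies T r ?M" for y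
      using that assms(4) unfolding spread_bounded_def by blast
    moreover have "x \<in> (\<lambda>G. card (\<Union>G) - card (\<Inter>G)) ` copies T r ?M"
      using G by blast
    ultimately have "Max ((\<lambda>G. card (\<Union>G) - card (\<Inter>G)) ` copies T r ?M) = x"
      by (rule Max_eqI)
    then show ?thesis
      by (simp only: x_number_at_def middle_levels_def e setcompr_eq_image Collect_mem_eq)
  qed
  have ev: "\<forall>\<^sub>F n in sequentially. x_number_at T r n = x"
    using at unfolding eventually_sequentially by blast
  show ?thesis
    unfolding x_number_def
  proof (rule the_equality)
    show "\<forall>\<^sub>F n in sequentially. x_number_at T r n = x"
      by (rule ev)
  next
    fix y assume "\<forall>\<^sub>F n in sequentially. x_number_at T r n = y"
    with ev have "\<forall>\<^sub>F n::nat in sequentially. x = y"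
      by eventually_elim simp
    then show "y = x"
      by simp
  qed
qed

section \<open>Upward monotone trees and the general case\<close>

lemma upward_monotone_supersaturated:
  assumes "tree_poset T r" "upward_monotone T r"
  obtains x where "spread_attained T r x" "spread_bounded T r x" "supersaturated T r x"
proof -
  obtain root par where "rooted_tree_order T r root par"
    using upward_monotone_rooted[OF assms] by blast
  then interpret rooted_tree_order T r root par .
  have "spread_attained T r width"
    unfolding spread_attained_def by (intro allI impI ex_copy_spread) auto
  moreover have "spread_bounded T r width"
    unfolding spread_bounded_def using copy_spread_le by blast
  moreover have "supersaturated T r width"
    unfolding supersaturated_def by (intro allI impI card_copies_ge)
  ultimately show thesis
    by (rule that)
qed

lemma hasse_arc_converse: "hasse_arc (r\<inverse>) p q \<longleftrightarrow> hasse_arc r q p"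
  by (auto simp: hasse_arc_def)

lemma tree_poset_converse:
  assumes "tree_poset T r"
  shows "tree_poset T (r\<inverse>)"
proof -
  have "hasse_edge (r\<inverse>) = hasse_edge r"
    by (intro ext) (auto simp: hasse_edge_def hasse_arc_converse)
  then show ?thesis
    using assms by (simp add: tree_poset_def finite_poset_def)
qed

theorem theorem1p6:
  fixes T :: "'a set" and r :: "'a rel" and \<epsilon> :: real
  assumes "monotone_tree_poset T r" and "\<epsilon> > 0"
  shows "\<exists>\<delta>>0. \<exists>n0. \<forall>n\<ge>n0. \<forall>F. F \<subseteq> Pow {1..n} \<longrightarrow>
           real (card F) \<ge> (real (poset_height T r) - 1 + \<epsilon>) * real (n choose (n div 2)) \<longrightarrow>
           real (card (copies T r F)) \<ge>
             \<delta> * real n ^ x_number T r * real (n choose (n div 2))"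
proof -
  have tree: "tree_poset T r" and mono: "upward_monotone T r \<or> downward_monotone T r"
    using assms(1) by (auto simp: monotone_tree_poset_def)
  have T: "finite_poset T r" "T \<noteq> {}"
    using tree by (auto simp: tree_poset_def undirected_tree_def)
  obtain x where x: "spread_attained T r x" "spread_bounded T r x" "supersaturated T r x"
    using mono
  proof
    assume "upward_monotone T r"
    with tree show thesis
      by (rule upward_monotone_supersaturated) (rule that)
  next
    \<comment> \<open>The converse order is upward monotone, and all three properties return to
      \<open>r\<close> by complementation with the same \<open>x\<close>.\<close>
    assume "downward_monotone T r"
    then have "upward_monotone T (r\<inverse>)"
      by (simp add: upward_monotone_def downward_monotone_def hasse_arc_converse)
    with tree_poset_converse[OF tree] obtain x where
      x: "spread_attained T (r\<inverse>) x" "spread_bounded T (r\<inverse>) x" "supersaturated T (r\<inverse>) x"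
      by (rule upward_monotone_supersaturated)
    show thesis
      by (rule that[OF spread_attained_converse[OF T(2) x(1)] spread_bounded_converse[OF T(2) x(2)]
            supersaturated_converse[OF x(3)]])
  qed
  have "x_number T r = x"
    using T x(1,2) by (rule x_number_eq)
  with x(3)[unfolded supersaturated_def, THEN spec, THEN mp, OF assms(2)] show ?thesis
    by (simp only:)
qed

end
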